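(* Let $\Omega$ be a compact metric space, $T:\Omega\to\Omega$ a minimal homeomorphism, $\mu$ a $T$-invariant ergodic Borel probability measure, $f:\Omega\to\mathbb{R}$ continuous, and $a_{-d},\dots,a_d$ real ($d\ge1$) with $a_k=a_{-k}$, $a_d\ne0$. If the operator family $L_{f,\omega}$ is $PH2$, then for every $\omega\in\Omega$ the point spectrum of $L_{f,\omega}$ is simple, i.e. every eigenvalue of $L_{f,\omega}$ has a one-dimensional eigenspace in $\ell^2(\mathbb{Z})$.
   Context: $(L_{f,\omega}u)(n)=\sum_{k=-d}^d a_ku(n+k)+f(T^n\omega)u(n)$ on $\ell^2(\mathbb{Z})$; its spectrum $\Sigma_f$ is independent of $\omega$. For $E\in\mathbb{C}$, $L_E^f(\omega)$ is the $2d\times2d$ matrix with first row $\frac1{a_d}(-a_{d-1},\dots,-a_1,E-f(\omega)-a_0,-a_{-1},\dots,-a_{-d})$ and $(j+1)$-th row $e_j^T$ ($j=1,\dots,2d-1$). The cocycle $(T,L_E^f)$ has iterates $(L_E^f)_n(\omega)=L_E^f(T^{n-1}\omega)\cdots L_E^f(\omega)$ and Lyapunov exponents (w.r.t. $\mu$) $L_1\ge\dots\ge L_{2d}$; $L^i_f(E):=L_i$, $i=1,\dots,d$. A cocycle $(T,A)$ on $\mathbb{C}^m$ is $k$-dominated if there is a continuous invariant splitting $\mathbb{C}^m=E^+(\omega)\oplus E^-(\omega)$ with $\dim E^+=k$ and $N\ge1$ with $\|A_N(\omega)u\|>\|A_N(\omega)w\|$ for all $\omega$ and unit $u\in E^+(\omega)$,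 $w\in E^-(\omega)$. $L_{f,\omega}$ is $PH2$ if for every $E\in\Sigma_f$, $L^{d-1}_f(E)>L^d_f(E)$ and $(T,L_E^f)$ is $(d-1)$- and $(d+1)$-dominated. *)

theory Defs
  imports "HOL-Probability.Probability" "Jordan_Normal_Form.Matrix" "Jordan_Normal_Form.Determinant"
begin

definition ipow :: "('a \<Rightarrow> 'a) \<Rightarrow> int \<Rightarrow> 'a \<Rightarrow> 'a" where
  "ipow T n = (if n \<ge> 0 then compow (nat n) T else compow (nat (- n)) (inv_into UNIV T))"

definition minimal_homeo :: "('a::topological_space \<Rightarrow> 'a) \<Rightarrow> bool" where
  "minimal_homeo T \<longleftrightarrow> (\<exists>S. homeomorphism UNIV UNIV T S) \<and>
     (\<forall>K. closed K \<and> T ` K = K \<longrightarrow> K = {} \<or> K = UNIV)"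

definition invariant_ergodic :: "'a measure \<Rightarrow> ('a \<Rightarrow> 'a) \<Rightarrow> bool" where
  "invariant_ergodic M T \<longleftrightarrow> T \<in> M \<rightarrow>\<^sub>M M \<and> distr M M T = M \<and>
     (\<forall>A\<in>sets M. T -` A \<inter> space M = A \<longrightarrow> emeasure M A = 0 \<or> emeasure M A = 1)"

definition ell2 :: "(int \<Rightarrow> complex) set" where
  "ell2 = {u. (\<lambda>n. (cmod (u n))\<^sup>2) summable_on UNIV}"

definition Lop :: "(int \<Rightarrow> real) \<Rightarrow> nat \<Rightarrow> ('a \<Rightarrow> real) \<Rightarrow> ('a \<Rightarrow> 'a) \<Rightarrow> 'a
    \<Rightarrow> (int \<Rightarrow> complex) \<Rightarrow> (int \<Rightarrow> complex)" where
  "Lop a d f T \<omega> u = (\<lambda>n. (\<Sum>k\<in>{- int d..int d}. complex_of_real (a k) * u (n + k))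
                           + complex_of_real (f (ipow T n \<omega>)) * u n)"

text \<open>Spectrum of the (bounded) operator on ell^2: E such that L - E is not a
  bijection of ell^2 (bounded inverse is automatic by the open mapping theorem).\<close>
definition op_spectrum :: "(int \<Rightarrow> real) \<Rightarrow> nat \<Rightarrow> ('a \<Rightarrow> real) \<Rightarrow> ('a \<Rightarrow> 'a) \<Rightarrow> 'a
    \<Rightarrow> complex set" where
  "op_spectrum a d f T \<omega> =
     {E. \<not> bij_betw (\<lambda>u n. Lop a d f T \<omega> u n - E * u n) ell2 ell2}"

text \<open>Sigma_f (independent of omega; we take the union over omega).\<close>
definition Sigma_f :: "(int \<Rightarrow> real) \<Rightarrow> nat \<Rightarrow> ('a \<Rightarrow> real) \<Rightarrow> ('a \<Rightarrow> 'a) \<Rightarrow> complex set" where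
  "Sigma_f a d f T = (\<Union>\<omega>. op_spectrum a d f T \<omega>)"

definition eigenspace_L :: "(int \<Rightarrow> real) \<Rightarrow> nat \<Rightarrow> ('a \<Rightarrow> real) \<Rightarrow> ('a \<Rightarrow> 'a) \<Rightarrow> 'a
    \<Rightarrow> complex \<Rightarrow> (int \<Rightarrow> complex) set" where
  "eigenspace_L a d f T \<omega> E = {u \<in> ell2. Lop a d f T \<omega> u = (\<lambda>n. E * u n)}"

definition is_eigenvalue_L :: "(int \<Rightarrow> real) \<Rightarrow> nat \<Rightarrow> ('a \<Rightarrow> real) \<Rightarrow> ('a \<Rightarrow> 'a) \<Rightarrow> 'a
    \<Rightarrow> complex \<Rightarrow> bool" where
  "is_eigenvalue_L a d f T \<omega> E \<longleftrightarrow> (\<exists>u \<in> eigenspace_L a d f T \<omega> E. u \<noteq> (\<lambda>n. 0))"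

definition cinner :: "complex vec \<Rightarrow> complex vec \<Rightarrow> complex" where
  "cinner u v = (\<Sum>i<dim_vec u. u $ i * cnj (v $ i))"

definition vnorm :: "complex vec \<Rightarrow> real" where
  "vnorm v = sqrt (\<Sum>i<dim_vec v. (cmod (v $ i))\<^sup>2)"

definition orthonormal_list :: "nat \<Rightarrow> complex vec list \<Rightarrow> bool" where
  "orthonormal_list m vs \<longleftrightarrow> set vs \<subseteq> carrier_vec m \<and>
     (\<forall>i<length vs. \<forall>j<length vs. cinner (vs ! i) (vs ! j) = (if i = j then 1 else 0))"

definition cspan :: "nat \<Rightarrow> complex vec list \<Rightarrow> complex vec set" where
  "cspan m vs = {finsum_vec TYPE(complex) m (\<lambda>i. c i \<cdot>\<^sub>v vs ! i) {..<length vs} | c. True}"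

definition lin_indep :: "nat \<Rightarrow> complex vec list \<Rightarrow> bool" where
  "lin_indep m vs \<longleftrightarrow> set vs \<subseteq> carrier_vec m \<and>
     (\<forall>c. finsum_vec TYPE(complex) m (\<lambda>i. c i \<cdot>\<^sub>v vs ! i) {..<length vs} = 0\<^sub>v m
          \<longrightarrow> (\<forall>i<length vs. c i = 0))"

definition subspace_dim :: "nat \<Rightarrow> complex vec set \<Rightarrow> nat \<Rightarrow> bool" where
  "subspace_dim m V k \<longleftrightarrow> (\<exists>vs. length vs = k \<and> lin_indep m vs \<and> V = cspan m vs)"

definition orth_proj :: "nat \<Rightarrow> complex vec set \<Rightarrow> complex mat \<Rightarrow> bool" where
  "orth_proj m V P \<longleftrightarrow> P \<in> carrier_mat m m \<and> P * P = P \<and>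
     (\<forall>i<m. \<forall>j<m. P $$ (i, j) = cnj (P $$ (j, i))) \<and>
     V = {P *\<^sub>v v | v. v \<in> carrier_vec m}"

text \<open>Continuity of a family of subspaces (Grassmannian topology, via the
  orthogonal projections).\<close>
definition continuous_subspaces :: "nat \<Rightarrow> ('a::topological_space \<Rightarrow> complex vec set) \<Rightarrow> bool" where
  "continuous_subspaces m V \<longleftrightarrow> (\<exists>P. (\<forall>\<omega>. orth_proj m (V \<omega>) (P \<omega>)) \<and>
     (\<forall>i<m. \<forall>j<m. continuous_on UNIV (\<lambda>\<omega>. P \<omega> $$ (i, j))))"

fun cocycle_iter :: "nat \<Rightarrow> ('a \<Rightarrow> 'a) \<Rightarrow> ('a \<Rightarrow> complex mat) \<Rightarrow> nat \<Rightarrow> 'a \<Rightarrow> complex mat" where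
  "cocycle_iter m T A 0 \<omega> = 1\<^sub>m m"
| "cocycle_iter m T A (Suc n) \<omega> = A (compow n T \<omega>) * cocycle_iter m T A n \<omega>"

definition transfer :: "(int \<Rightarrow> real) \<Rightarrow> nat \<Rightarrow> ('a \<Rightarrow> real) \<Rightarrow> complex \<Rightarrow> 'a \<Rightarrow> complex mat" where
  "transfer a d f E \<omega> = mat (2 * d) (2 * d) (\<lambda>(i, j).
     if i = 0 then
       ((if j = d - 1 then E - complex_of_real (f \<omega>) else 0)
          - complex_of_real (a (int d - 1 - int j))) / complex_of_real (a (int d))
     else if j + 1 = i then 1 else 0)"

text \<open>Norm of the k-th exterior power of A: the supremum of the k-volumes of the
  images of orthonormal k-frames (= product of the k largest singular values).\<close>
definition ext_norm :: "nat \<Rightarrow> nat \<Rightarrow> complex mat \<Rightarrow> real" where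
  "ext_norm m k A = Sup {sqrt (cmod (det (mat k k (\<lambda>(i, j). cinner (A *\<^sub>v vs ! i) (A *\<^sub>v vs ! j)))))
                        | vs. length vs = k \<and> orthonormal_list m vs}"

definition lyap_sum :: "'a measure \<Rightarrow> ('a \<Rightarrow> 'a) \<Rightarrow> nat \<Rightarrow> ('a \<Rightarrow> complex mat) \<Rightarrow> nat \<Rightarrow> real" where
  "lyap_sum M T m A k =
     lim (\<lambda>n. (\<integral>\<omega>. ln (ext_norm m k (cocycle_iter m T A n \<omega>)) \<partial>M) / real n)"

text \<open>The i-th Lyapunov exponent L_i (i >= 1), L_1 >= ... >= L_m.\<close>
definition lyap :: "'a measure \<Rightarrow> ('a \<Rightarrow> 'a) \<Rightarrow> nat \<Rightarrow> ('a \<Rightarrow> complex mat) \<Rightarrow> nat \<Rightarrow> real" where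
  "lyap M T m A i = lyap_sum M T m A i - lyap_sum M T m A (i - 1)"

definition dominated :: "('a::topological_space \<Rightarrow> 'a) \<Rightarrow> nat \<Rightarrow> ('a \<Rightarrow> complex mat) \<Rightarrow> nat \<Rightarrow> bool" where
  "dominated T m A k \<longleftrightarrow> (\<exists>Ep Em.
     continuous_subspaces m Ep \<and> continuous_subspaces m Em \<and>
     (\<forall>\<omega>. subspace_dim m (Ep \<omega>) k \<and> (\<exists>k'. subspace_dim m (Em \<omega>) k')) \<and>
     (\<forall>\<omega>. Ep \<omega> \<inter> Em \<omega> = {0\<^sub>v m} \<and> {u + w | u w. u \<in> Ep \<omega> \<and> w \<in> Em \<omega>} = carrier_vec m) \<and>
     (\<forall>\<omega>. (\<lambda>v. A \<omega> *\<^sub>v v) ` Ep \<omega> = Ep (T \<omega>) \<and> (\<lambda>v. A \<omega> *\<^sub>v v) ` Em \<omega> = Em (T \<omega>)) \<and>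
     (\<exists>N\<ge>1. \<forall>\<omega> u w. u \<in> Ep \<omega> \<and> w \<in> Em \<omega> \<and> vnorm u = 1 \<and> vnorm w = 1 \<longrightarrow>
        vnorm (cocycle_iter m T A N \<omega> *\<^sub>v u) > vnorm (cocycle_iter m T A N \<omega> *\<^sub>v w)))"

text \<open>PH2 (for d = 1 the exponent condition is vacuous: L^0 = +infinity).\<close>
definition PH2 :: "'a::topological_space measure \<Rightarrow> ('a \<Rightarrow> 'a) \<Rightarrow> (int \<Rightarrow> real) \<Rightarrow> nat
    \<Rightarrow> ('a \<Rightarrow> real) \<Rightarrow> bool" where
  "PH2 M T a d f \<longleftrightarrow> (\<forall>E\<in>Sigma_f a d f T.
     (d \<ge> 2 \<longrightarrow> lyap M T (2 * d) (transfer a d f E) (d - 1) > lyap M T (2 * d) (transfer a d f E) d) \<and>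
     dominated T (2 * d) (transfer a d f E) (d - 1) \<and>
     dominated T (2 * d) (transfer a d f E) (d + 1))"

end

theory Submission
  imports Defs
begin

text \<open>The Wronskian of the difference operator is a symplectic form on \<open>\<complex>\<^sup>2\<^sup>d\<close> preserved by the
  transfer matrices, so a subspace all of whose orbits tend to \<open>0\<close> along a common sequence of times is
  isotropic and has dimension at most \<open>d\<close>. Let \<open>E\<^sup>+ \<oplus> E\<^sup>-\<close> be the splitting given by
  \<open>(d + 1)\<close>-domination. If an eigenvector did not lie in \<open>E\<^sup>+\<close>, its backward decay would force
  backward decay on \<open>E\<^sup>+\<close>, of dimension \<open>d + 1\<close>. Hence eigenvectors lie in \<open>E\<^sup>+\<close>, their forward decay
  forces forward decay on \<open>E\<^sup>-\<close>, and \<open>E\<^sup>-\<close>, of dimension \<open>d - 1\<close>, together with two independent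
  eigenvectors would again span an isotropic space of dimension \<open>d + 1\<close>.\<close>

unbundle no vec_syntax

section \<open>Linear algebra in coordinates\<close>

text \<open>The obstacle is that \<open>dominated\<close> states no contraction rate: by itself it
  makes no orbit decay. It only says that, along the times \<open>k * N\<close>, the norm of an
  \<open>Em\<close>-orbit relative to that of an \<open>Ep\<close>-orbit does not grow. All decay is
  therefore imported from square-summability and passed on by this one inequality, read from the
  initial point in forward time and from the endpoint in backward time. Convergence to 0 without a
  rate is enough, because the Wronskian of two orbits is constant. In backward time orbit vectors
  are split at moving base points, where the angle between \<open>Ep\<close> and \<open>Em\<close>
  might degenerate; continuity of the splitting and compactness of the base exclude this. The form
  is bilinear, without conjugation, so that it is preserved for every complex \<open>E\<close>;
  conjugates occur only in auxiliary orthogonality arguments in coordinates.\<close>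

lemma sum_lessThan_add: "(\<Sum>i<p + q. f i) = (\<Sum>i<p. f i) + (\<Sum>i<q. f (p + i :: nat))"
  by (induction q) (auto simp: add.assoc)

text \<open>Row \<open>p < n\<close> of a square matrix is set to zero, so its determinant vanishes
  and it has a nonzero kernel vector. The rows above row \<open>p\<close> are the given equations;
  those below it are arbitrary and do no harm.\<close>

lemma underdetermined_system:
  fixes A :: "nat \<Rightarrow> nat \<Rightarrow> 'a::idom"
  assumes "p < n"
  shows "\<exists>y. (\<exists>i<n. y i \<noteq> 0) \<and> (\<forall>j<p. (\<Sum>i<n. A j i * y i) = 0)"
proof -
  define B where "B = mat\<^sub>r n n (\<lambda>j. if j = p then 0\<^sub>v n else vec n (A j))"
  have B: "B \<in> carrier_mat n n"
    by (simp add: B_def)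
  have "det B = 0"
    unfolding B_def by (rule det_row_0) (use assms in auto)
  then obtain v where v: "v \<in> carrier_vec n" "v \<noteq> 0\<^sub>v n" "B *\<^sub>v v = 0\<^sub>v n"
    using det_0_iff_vec_prod_zero[OF B] by auto
  have "\<exists>i<n. v $ i \<noteq> 0"
    using v(1,2) by (metis carrier_vecD eq_vecI index_zero_vec)
  moreover have "(\<Sum>i<n. A j i * v $ i) = 0" if "j < p" for j
  proof -
    have "0 = (B *\<^sub>v v) $ j"
      using v that assms by simp
    also have "\<dots> = (\<Sum>i<n. A j i * v $ i)"
      using that assms v(1)
      by (auto simp: B_def scalar_prod_def atLeast0LessThan intro!: sum.cong)
    finally show ?thesis by simp
  qed
  ultimately show ?thesis
    by (intro exI[of _ "\<lambda>i. v $ i"]) blast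
qed

lemma sum_mult_cnj_eq_0:
  fixes y :: "'b \<Rightarrow> complex"
  assumes "finite I" "(\<Sum>i\<in>I. y i * cnj (y i)) = 0" "i \<in> I"
  shows "y i = 0"
proof -
  have "of_real (\<Sum>i\<in>I. (cmod (y i))\<^sup>2) = (\<Sum>i\<in>I. y i * cnj (y i))"
    by (simp only: complex_norm_square of_real_sum)
  then have "(\<Sum>i\<in>I. (cmod (y i))\<^sup>2) = 0"
    unfolding assms(2) by (simp only: of_real_eq_0_iff)
  then show ?thesis
    using assms(1,3) by (simp add: sum_nonneg_eq_0_iff)
qed

text \<open>If \<open>p < n\<close>, some nonzero \<open>y\<close> is annihilated by all
  \<open>v j\<close> in the bilinear pairing. Its conjugate is a combination of the
  \<open>v j\<close>, so the squared norm of \<open>y\<close> is zero.\<close>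

lemma spanning_family_length:
  fixes v :: "nat \<Rightarrow> nat \<Rightarrow> complex"
  assumes "\<And>y. \<exists>c. \<forall>i<n. y i = (\<Sum>j<p. c j * v j i)"
  shows "n \<le> p"
proof (rule ccontr)
  assume "\<not> n \<le> p"
  then obtain y where y: "\<exists>i<n. y i \<noteq> 0" "\<forall>j<p. (\<Sum>i<n. v j i * y i) = 0"
    using underdetermined_system[of p n v] by auto
  obtain c where c: "\<forall>i<n. cnj (y i) = (\<Sum>j<p. c j * v j i)"
    using assms[of "\<lambda>i. cnj (y i)"] by auto
  have "(\<Sum>i<n. y i * cnj (y i)) = (\<Sum>i<n. \<Sum>j<p. c j * (v j i * y i))"
    using c by (auto intro!: sum.cong simp: sum_distrib_left mult_ac)
  also have "\<dots> = (\<Sum>j<p. c j * (\<Sum>i<n. v j i * y i))"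
    by (subst sum.swap) (simp add: sum_distrib_left)
  also have "\<dots> = 0"
    by (rule sum.neutral) (simp add: y(2))
  finally have "(\<Sum>i<n. y i * cnj (y i)) = 0" .
  then show False
    using sum_mult_cnj_eq_0[of "{..<n}" y] y(1) by blast
qed

section \<open>The symplectic form\<close>

text \<open>The Wronskian of the difference operator. A vector of length \<open>2 * d\<close> lists the values
  \<open>u (n + d - 1), \<dots>, u (n - d)\<close> of a sequence in decreasing order, so that the pairs below are the
  values at distance \<open>k\<close> on either side of the cut between \<open>n - 1\<close> and \<open>n\<close>.\<close>

definition wronskian :: "(nat \<Rightarrow> complex) \<Rightarrow> nat \<Rightarrow> (nat \<Rightarrow> complex) \<Rightarrow> (nat \<Rightarrow> complex) \<Rightarrow> complex" where
  "wronskian b d x y = (\<Sum>k=1..d. b k * (\<Sum>i=d-k..<d. x (i + k) * y i - x i * y (i + k)))"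

lemma wronskian_cong:
  assumes "\<And>i. i < 2 * d \<Longrightarrow> x i = x' i" "\<And>i. i < 2 * d \<Longrightarrow> y i = y' i"
  shows "wronskian b d x y = wronskian b d x' y'"
  unfolding wronskian_def
  by (intro sum.cong refl arg_cong2[where f="(*)"] arg_cong2[where f="(-)"]) (use assms in auto)

lemma wronskian_sum_right: "wronskian b d x (\<lambda>i. \<Sum>j\<in>J. c j * y j i) = (\<Sum>j\<in>J. c j * wronskian b d x (y j))"
proof -
  have "wronskian b d x (\<lambda>i. \<Sum>j\<in>J. c j * y j i)
      = (\<Sum>k=1..d. b k * (\<Sum>i=d-k..<d. \<Sum>j\<in>J. c j * (x (i + k) * y j i - x i * y j (i + k))))"
    unfolding wronskian_def
    by (intro sum.cong refl arg_cong2[where f="(*)"])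
       (simp add: sum_distrib_left sum_subtractf[symmetric] algebra_simps)
  also have "\<dots> = (\<Sum>k=1..d. \<Sum>j\<in>J. c j * (b k * (\<Sum>i=d-k..<d. x (i + k) * y j i - x i * y j (i + k))))"
    by (intro sum.cong refl, subst sum.swap) (simp add: sum_distrib_left mult_ac)
  also have "\<dots> = (\<Sum>j\<in>J. c j * wronskian b d x (y j))"
    by (subst sum.swap) (simp add: wronskian_def sum_distrib_left)
  finally show ?thesis .
qed

lemma wronskian_commute: "wronskian b d x y = - wronskian b d y x"
  unfolding wronskian_def
  by (simp add: sum_negf[symmetric] mult_minus_right[symmetric] del: mult_minus_right)
     (simp add: mult.commute)

lemma wronskian_sum_left: "wronskian b d (\<lambda>i. \<Sum>j\<in>J. c j * x j i) y = (\<Sum>j\<in>J. c j * wronskian b d (x j) y)"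
  by (subst wronskian_commute) (simp add: wronskian_sum_right wronskian_commute[of b d y] sum_negf)

lemma wronskian_tendsto_0:
  assumes "\<And>i. i < 2 * d \<Longrightarrow> (\<lambda>n. x n i) \<longlonglongrightarrow> 0" "\<And>i. i < 2 * d \<Longrightarrow> (\<lambda>n. y n i) \<longlonglongrightarrow> 0"
  shows "(\<lambda>n. wronskian b d (x n) (y n)) \<longlonglongrightarrow> 0"
proof -
  have "(\<lambda>n. \<Sum>k=1..d. b k * (\<Sum>i=d-k..<d. x n (i + k) * y n i - x n i * y n (i + k)))
      \<longlonglongrightarrow> (\<Sum>k=1..d. b k * (\<Sum>i=d-k..<d. 0 * 0 - 0 * 0))"
    by (intro tendsto_intros assms) auto
  then show ?thesis
    by (simp add: wronskian_def)
qed

text \<open>Discrete Green identity. For each \<open>k\<close> the shift changes the inner sum by a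
  telescoping boundary term; weighted by \<open>b k\<close>, these terms add up to
  \<open>Y d\<close> times the left side of the first equation minus \<open>X d\<close> times that
  of the second, which cancels because both share the same \<open>e\<close>.\<close>

lemma wronskian_shift:
  assumes "(\<Sum>k=1..d. b k * (X (d + k) + X (d - k))) = e * X d"
    and "(\<Sum>k=1..d. b k * (Y (d + k) + Y (d - k))) = e * Y d"
  shows "wronskian b d (\<lambda>i. X (Suc i)) (\<lambda>i. Y (Suc i)) = wronskian b d X Y"
proof -
  define h where "h k i = X (i + k) * Y i - X i * Y (i + k)" for k i
  have tel: "(\<Sum>i=d-k..<d. h k (Suc i)) = (\<Sum>i=d-k..<d. h k i) + (h k d - h k (d - k))" for k
    using sum_Suc_diff'[of "d - k" d "h k"] by (simp add: sum_subtractf algebra_simps)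
  have "wronskian b d (\<lambda>i. X (Suc i)) (\<lambda>i. Y (Suc i)) = (\<Sum>k=1..d. b k * (\<Sum>i=d-k..<d. h k (Suc i)))"
    by (simp add: wronskian_def h_def)
  also have "\<dots> = wronskian b d X Y + (\<Sum>k=1..d. b k * (h k d - h k (d - k)))"
    unfolding tel by (simp add: wronskian_def h_def distrib_left sum.distrib)
  also have "(\<Sum>k=1..d. b k * (h k d - h k (d - k)))
      = (\<Sum>k=1..d. Y d * (b k * (X (d + k) + X (d - k))) - X d * (b k * (Y (d + k) + Y (d - k))))"
    by (intro sum.cong refl) (simp add: h_def algebra_simps)
  also have "\<dots> = 0"
    by (simp only: sum_subtractf sum_distrib_left[symmetric] assms) simp
  finally show ?thesis by simp
qed

text \<open>A row of the matrix of the form: it involves only \<open>x d\<close>, ...,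
  \<open>x (d + r)\<close>, and the last of these carries the coefficient \<open>b d\<close>. This
  triangular shape drives nondegeneracy.\<close>

lemma wronskian_unit_low:
  assumes "r < d"
  shows "wronskian b d x (\<lambda>i. of_bool (i = r)) = (\<Sum>k=d-r..d. b k * x (r + k))"
proof -
  have "wronskian b d x (\<lambda>i. of_bool (i = r)) = (\<Sum>k=1..d. b k * (\<Sum>i=d-k..<d. if i = r then x (i + k) else 0))"
    unfolding wronskian_def using assms
    by (intro sum.cong refl arg_cong2[where f="(*)"]) auto
  also have "\<dots> = (\<Sum>k=1..d. if d - r \<le> k then b k * x (r + k) else 0)"
    using assms by (intro sum.cong refl) auto
  also have "\<dots> = (\<Sum>k=d-r..d. b k * x (r + k))"
    using assms by (subst sum.inter_filter[symmetric]) (auto intro!: sum.cong)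
  finally show ?thesis .
qed

lemma wronskian_unit_high:
  assumes "s < d"
  shows "wronskian b d x (\<lambda>i. of_bool (i = d + s)) = - (\<Sum>k=Suc s..d. b k * x (d + s - k))"
proof -
  have "wronskian b d x (\<lambda>i. of_bool (i = d + s))
      = (\<Sum>k=1..d. b k * (\<Sum>i=d-k..<d. if i = d + s - k then - (if s < k then x (d + s - k) else 0) else 0))"
    unfolding wronskian_def using assms
    by (intro sum.cong refl arg_cong2[where f="(*)"]) auto
  also have "\<dots> = (\<Sum>k=1..d. if s < k then - (b k * x (d + s - k)) else 0)"
    using assms by (intro sum.cong refl) auto
  also have "\<dots> = - (\<Sum>k=Suc s..d. b k * x (d + s - k))"
    using assms by (subst sum.inter_filter[symmetric]) (auto intro!: sum.cong simp: sum_negf[symmetric])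
  finally show ?thesis .
qed

text \<open>The matrix of the form consists of two triangular blocks with \<open>b d\<close> or
  \<open>- b d\<close> at the corner of each row, so the entries can be solved for one at a time,
  starting from the middle index.\<close>

lemma wronskian_nondegenerate:
  assumes "b d \<noteq> 0" and "\<And>r. r < 2 * d \<Longrightarrow> wronskian b d x (\<lambda>i. of_bool (i = r)) = 0"
    and "i < 2 * d"
  shows "x i = 0"
proof -
  have high: "x (d + s) = 0" if "s < d" for s
    using that
  proof (induction s rule: less_induct)
    case (less s)
    have "0 = (\<Sum>k=d-s..d. b k * x (s + k))"
      using assms(2)[of s] less.prems by (simp add: wronskian_unit_low)
    also have "\<dots> = (\<Sum>k\<in>{d}. b k * x (s + k))"
    proof (rule sum.mono_neutral_right)
      show "\<forall>k\<in>{d-s..d} - {d}. b k * x (s + k) = 0"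
      proof
        fix k assume k: "k \<in> {d-s..d} - {d}"
        then have "x (d + (s + k - d)) = 0"
          using less.prems by (intro less.IH) auto
        then show "b k * x (s + k) = 0"
          using k by auto
      qed
    qed auto
    finally show ?case
      using assms(1) by (simp add: add.commute)
  qed
  \<comment> \<open>Row \<open>d + s\<close> couples \<open>x s\<close> to \<open>x (s + 1)\<close>,
    ..., \<open>x (d - 1)\<close>, so the lower half is solved downward; \<open>t\<close> counts the
    distance from \<open>d - 1\<close>.\<close>
  have low: "x (d - Suc t) = 0" if "t < d" for t
    using that
  proof (induction t rule: less_induct)
    case (less t)
    define s where "s = d - Suc t"
    have s: "s < d" using less.prems by (simp add: s_def)
    have "0 = (\<Sum>k=Suc s..d. b k * x (d + s - k))"
      using assms(2)[of "d + s"] s by (simp add: wronskian_unit_high)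
    also have "\<dots> = (\<Sum>k\<in>{d}. b k * x (d + s - k))"
    proof (rule sum.mono_neutral_right)
      show "\<forall>k\<in>{Suc s..d} - {d}. b k * x (d + s - k) = 0"
      proof
        fix k assume k: "k \<in> {Suc s..d} - {d}"
        then have "x (d - Suc (k - Suc s)) = 0"
          using less.prems s_def by (intro less.IH) auto
        then show "b k * x (d + s - k) = 0"
          using k by (auto simp: Suc_diff_Suc)
      qed
    qed (use s in auto)
    finally show ?case
      using assms(1) by (simp add: s_def)
  qed
  show ?thesis
  proof (cases "i < d")
    case True
    then show ?thesis using low[of "d - Suc i"] by simp
  next
    case False
    then show ?thesis using high[of "i - d"] assms(3) by simp
  qed
qed

text \<open>With \<open>J\<close> the matrix of the form, the conjugates of \<open>J v\<close> for \<open>v\<close> in an isotropic space \<open>V\<close> are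
  orthogonal to \<open>V\<close>, so \<open>2 dim V\<close> is at most the dimension \<open>2 d\<close> of the whole space.\<close>
lemma isotropic_dependent:
  fixes v :: "nat \<Rightarrow> nat \<Rightarrow> complex"
  assumes "b d \<noteq> 0" and "d < p" and iso: "\<And>i j. i < p \<Longrightarrow> j < p \<Longrightarrow> wronskian b d (v i) (v j) = 0"
  shows "\<exists>c. (\<exists>j<p. c j \<noteq> 0) \<and> (\<forall>r<2*d. (\<Sum>j<p. c j * v j r) = 0)"
proof -
  define J where "J x r = wronskian b d x (\<lambda>i. of_bool (i = r))" for x r
  have J: "wronskian b d x y = (\<Sum>r<2*d. y r * J x r)" for x y
  proof -
    have "wronskian b d x y = wronskian b d x (\<lambda>i. \<Sum>r<2*d. y r * of_bool (i = r))"
      by (rule wronskian_cong) (auto simp: of_bool_def if_distrib cong: if_cong)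
    then show ?thesis
      unfolding wronskian_sum_right J_def .
  qed
  \<comment> \<open>Its columns are the \<open>p\<close> vectors followed by the \<open>p\<close>
    conjugated images under \<open>J\<close>: \<open>2 * p\<close> columns of height
    \<open>2 * d\<close>, hence dependent.\<close>
  define A where "A r i = (if i < p then v i r else cnj (J (v (i - p)) r))" for r i
  obtain y where y: "\<exists>i<2*p. y i \<noteq> 0" "\<forall>r<2*d. (\<Sum>i<2*p. A r i * y i) = 0"
    using underdetermined_system[of "2*d" "2*p" A] assms(2) by auto
  define c where "c = y"
  define e where "e j = cnj (y (p + j))" for j
  define z where "z r = (\<Sum>j<p. e j * v j r)" for r
  have Jz: "J z r = (\<Sum>j<p. e j * J (v j) r)" for r
    by (simp add: J_def z_def[abs_def] wronskian_sum_left)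
  have dep: "(\<Sum>j<p. c j * v j r) + cnj (J z r) = 0" if "r < 2*d" for r
  proof -
    have "0 = (\<Sum>i<p+p. A r i * y i)"
      using y(2) that by (simp add: mult_2)
    also have "\<dots> = (\<Sum>i<p. A r i * y i) + (\<Sum>j<p. A r (p + j) * y (p + j))"
      by (rule sum_lessThan_add)
    also have "\<dots> = (\<Sum>j<p. c j * v j r) + cnj (J z r)"
      by (simp add: A_def Jz c_def e_def mult.commute)
    finally show ?thesis by simp
  qed
  \<comment> \<open>Pairing the dependency with \<open>J z\<close> turns its first half into a
    Wronskian of two combinations of the \<open>v j\<close>, which vanishes by isotropy; what
    remains is the squared norm of \<open>J z\<close>.\<close>
  have "(\<Sum>r<2*d. J z r * cnj (J z r)) = - (\<Sum>r<2*d. (\<Sum>j<p. c j * v j r) * J z r)"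
  proof -
    have "J z r * cnj (J z r) = - ((\<Sum>j<p. c j * v j r) * J z r)" if "r < 2*d" for r
      unfolding eq_neg_iff_add_eq_0[THEN iffD2, OF dep[OF that]] by simp
    then show ?thesis
      by (simp add: sum_negf)
  qed
  also have "(\<Sum>r<2*d. (\<Sum>j<p. c j * v j r) * J z r) = wronskian b d z (\<lambda>r. \<Sum>j<p. c j * v j r)"
    by (rule J[symmetric])
  also have "wronskian b d z (\<lambda>r. \<Sum>j<p. c j * v j r) = 0"
    unfolding wronskian_sum_right z_def[abs_def] wronskian_sum_left using iso by simp
  finally have "(\<Sum>r<2*d. J z r * cnj (J z r)) = 0"
    by simp
  then have Jz0: "J z r = 0" if "r < 2*d" for r
    by (rule sum_mult_cnj_eq_0[rotated]) (use that in simp_all)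
  have z0: "z r = 0" if "r < 2*d" for r
    using wronskian_nondegenerate[where b = b and d = d and x = z and i = r] assms(1) Jz0 that
    by (simp add: J_def)
  \<comment> \<open>Both halves are now relations among the \<open>v j\<close>: \<open>c\<close>
    because \<open>J z\<close> vanishes, \<open>e\<close> because \<open>z\<close> then vanishes by
    nondegeneracy. A nonzero coefficient lies in one of them.\<close>
  from y(1) obtain i where i: "i < 2*p" "y i \<noteq> 0" by auto
  show ?thesis
  proof (cases "i < p")
    case True
    then show ?thesis
      using dep Jz0 i by (intro exI[of _ c]) (auto simp: c_def)
  next
    case False
    then have "i - p < p" "e (i - p) \<noteq> 0"
      using i by (auto simp: e_def)
    then show ?thesis
      using z0 by (intro exI[of _ e]) (auto simp: z_def)
  qed
qed

section \<open>Coordinate vectors and subspaces\<close>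

lemma vnorm_nonneg: "0 \<le> vnorm v"
  by (simp add: vnorm_def sum_nonneg)

lemma norm_index_le_vnorm:
  assumes "i < dim_vec v"
  shows "cmod (v $ i) \<le> vnorm v"
proof -
  have "(cmod (v $ i))\<^sup>2 \<le> (\<Sum>i<dim_vec v. (cmod (v $ i))\<^sup>2)"
    using assms by (intro member_le_sum) auto
  then show ?thesis
    by (simp add: vnorm_def real_le_rsqrt)
qed

lemma vnorm_eq_0_iff:
  assumes "v \<in> carrier_vec m"
  shows "vnorm v = 0 \<longleftrightarrow> v = 0\<^sub>v m"
proof
  assume "vnorm v = 0"
  then have "v $ i = 0" if "i < m" for i
    using norm_index_le_vnorm[of i v] that assms by auto
  then show "v = 0\<^sub>v m"
    using assms by (intro eq_vecI) auto
qed (simp add: vnorm_def)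

lemma vnorm_smult: "vnorm (c \<cdot>\<^sub>v v) = cmod c * vnorm v"
proof -
  have "(\<Sum>i<dim_vec (c \<cdot>\<^sub>v v). (cmod ((c \<cdot>\<^sub>v v) $ i))\<^sup>2) = (cmod c)\<^sup>2 * (\<Sum>i<dim_vec v. (cmod (v $ i))\<^sup>2)"
    by (simp add: sum_distrib_left norm_mult power_mult_distrib)
  then show ?thesis
    by (simp add: vnorm_def real_sqrt_mult)
qed

lemma vnorm_tendsto_0_iff:
  assumes "\<And>k. x k \<in> carrier_vec m"
  shows "(\<lambda>k. vnorm (x k)) \<longlonglongrightarrow> 0 \<longleftrightarrow> (\<forall>i<m. (\<lambda>k. x k $ i) \<longlonglongrightarrow> 0)"
proof
  assume l: "(\<lambda>k. vnorm (x k)) \<longlonglongrightarrow> 0"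
  show "\<forall>i<m. (\<lambda>k. x k $ i) \<longlonglongrightarrow> 0"
  proof (intro allI impI)
    fix i assume "i < m"
    then show "(\<lambda>k. x k $ i) \<longlonglongrightarrow> 0"
      by (intro Lim_null_comparison[OF _ l] always_eventually allI norm_index_le_vnorm)
         (simp add: carrier_vecD[OF assms])
  qed
next
  assume r: "\<forall>i<m. (\<lambda>k. x k $ i) \<longlonglongrightarrow> 0"
  have "(\<lambda>k. sqrt (\<Sum>i<m. (cmod (x k $ i))\<^sup>2)) \<longlonglongrightarrow> sqrt (\<Sum>i<m. (cmod 0)\<^sup>2)"
    by (intro tendsto_intros) (use r in auto)
  then show "(\<lambda>k. vnorm (x k)) \<longlonglongrightarrow> 0"
    using carrier_vecD[OF assms] by (simp add: vnorm_def)
qed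

lemma mult_mat_vec_index:
  assumes "A \<in> carrier_mat n m" "v \<in> carrier_vec m" "i < n"
  shows "(A *\<^sub>v v) $ i = (\<Sum>j<m. A $$ (i, j) * v $ j)"
  using assms by (simp add: scalar_prod_def atLeast0LessThan)

lemma lincomb_carrier:
  assumes "set vs \<subseteq> carrier_vec m"
  shows "finsum_vec TYPE(complex) m (\<lambda>i. c i \<cdot>\<^sub>v vs ! i) {..<length vs} \<in> carrier_vec m"
  using assms by (intro finsum_vec_closed) (auto intro!: smult_carrier_vec[THEN iffD2] simp: subset_iff)

lemma lincomb_index:
  assumes "set vs \<subseteq> carrier_vec m" "r < m"
  shows "finsum_vec TYPE(complex) m (\<lambda>i. c i \<cdot>\<^sub>v vs ! i) {..<length vs} $ r
    = (\<Sum>i<length vs. c i * (vs ! i) $ r)"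
proof -
  have car: "vs ! i \<in> carrier_vec m" if "i < length vs" for i
    using assms(1) that by (auto simp: subset_iff)
  have "finsum_vec TYPE(complex) m (\<lambda>i. c i \<cdot>\<^sub>v vs ! i) {..<length vs} $ r
      = (\<Sum>i<length vs. (c i \<cdot>\<^sub>v vs ! i) $ r)"
    by (rule index_finsum_vec) (use car assms(2) in auto)
  also have "\<dots> = (\<Sum>i<length vs. c i * (vs ! i) $ r)"
    using car assms(2) by (intro sum.cong refl index_smult_vec) (auto dest: carrier_vecD)
  finally show ?thesis .
qed

lemma nth_in_cspan:
  assumes "set vs \<subseteq> carrier_vec m" "j < length vs"
  shows "vs ! j \<in> cspan m vs"
proof -
  have car: "vs ! j \<in> carrier_vec m"
    using assms by auto
  have "vs ! j = finsum_vec TYPE(complex) m (\<lambda>i. of_bool (i = j) \<cdot>\<^sub>v vs ! i) {..<length vs}"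
  proof (rule eq_vecI)
    fix r assume "r < dim_vec (finsum_vec TYPE(complex) m (\<lambda>i. of_bool (i = j) \<cdot>\<^sub>v vs ! i) {..<length vs})"
    then have "r < m"
      using carrier_vecD[OF lincomb_carrier[OF assms(1)]] by simp
    then show "vs ! j $ r = finsum_vec TYPE(complex) m (\<lambda>i. of_bool (i = j) \<cdot>\<^sub>v vs ! i) {..<length vs} $ r"
      using assms by (simp add: lincomb_index of_bool_def if_distrib[of "\<lambda>x. x * _"] cong: if_cong)
  qed (use carrier_vecD[OF lincomb_carrier[OF assms(1)]] carrier_vecD[OF car] in simp)
  then show ?thesis
    unfolding cspan_def mem_Collect_eq by (intro exI conjI TrueI)
qed

lemma isotropic_length_le:
  assumes "b d \<noteq> 0" and indep: "lin_indep (2 * d) vs"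
    and iso: "\<And>x y. x \<in> set vs \<Longrightarrow> y \<in> set vs \<Longrightarrow> wronskian b d (($) x) (($) y) = 0"
  shows "length vs \<le> d"
proof (rule ccontr)
  assume "\<not> length vs \<le> d"
  then have "d < length vs" by simp
  from isotropic_dependent[where b = b and v = "\<lambda>i. ($) (vs ! i)", OF assms(1) this] iso
  obtain c where c: "\<exists>j<length vs. c j \<noteq> 0" "\<forall>r<2*d. (\<Sum>j<length vs. c j * vs ! j $ r) = 0"
    by auto
  have car: "set vs \<subseteq> carrier_vec (2 * d)"
    using indep by (simp add: lin_indep_def)
  have "finsum_vec TYPE(complex) (2 * d) (\<lambda>i. c i \<cdot>\<^sub>v vs ! i) {..<length vs} = 0\<^sub>v (2 * d)"
    using c(2) carrier_vecD[OF lincomb_carrier[OF car]] by (intro eq_vecI) (auto simp: lincomb_index[OF car])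
  then show False
    using c(1) indep by (auto simp: lin_indep_def)
qed

text \<open>\<open>dominated\<close> prescribes the dimension of \<open>Ep\<close> only; this
  supplies the lower bound for the dimension of \<open>Em\<close>.\<close>

lemma dim_le_sum_dims:
  assumes "subspace_dim m V p" "subspace_dim m W q"
    and "{u + w | u w. u \<in> V \<and> w \<in> W} = carrier_vec m"
  shows "m \<le> p + q"
proof -
  obtain vs where vs: "length vs = p" "lin_indep m vs" "V = cspan m vs"
    using assms(1) by (auto simp: subspace_dim_def)
  obtain ws where ws: "length ws = q" "lin_indep m ws" "W = cspan m ws"
    using assms(2) by (auto simp: subspace_dim_def)
  have car: "set vs \<subseteq> carrier_vec m" "set ws \<subseteq> carrier_vec m"
    using vs ws by (auto simp: lin_indep_def)
  show ?thesis
  proof (rule spanning_family_length)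
    fix y :: "nat \<Rightarrow> complex"
    have "vec m y \<in> {u + w | u w. u \<in> V \<and> w \<in> W}"
      using assms(3) by simp
    then obtain c e where ce: "vec m y = finsum_vec TYPE(complex) m (\<lambda>i. c i \<cdot>\<^sub>v vs ! i) {..<length vs}
        + finsum_vec TYPE(complex) m (\<lambda>i. e i \<cdot>\<^sub>v ws ! i) {..<length ws}"
      unfolding vs(3) ws(3) cspan_def by blast
    have "y r = (\<Sum>j<p+q. (if j < p then c j else e (j - p)) * (if j < p then vs ! j else ws ! (j - p)) $ r)"
      if "r < m" for r
    proof -
      have "y r = vec m y $ r"
        using that by simp
      also have "\<dots> = (\<Sum>j<p. c j * vs ! j $ r) + (\<Sum>j<q. e j * ws ! j $ r)"
        unfolding ce using that carrier_vecD[OF lincomb_carrier[OF car(2)]]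
        by (simp add: lincomb_index[OF car(1), unfolded vs(1)] lincomb_index[OF car(2), unfolded ws(1)] vs(1) ws(1))
      finally show ?thesis
        by (simp add: sum_lessThan_add)
    qed
    then show "\<exists>c. \<forall>r<m. y r = (\<Sum>j<p+q. c j * (if j < p then vs ! j else ws ! (j - p)) $ r)"
      by (intro exI allI impI)
  qed
qed

section \<open>Subspaces as ranges of orthogonal projections\<close>

lemma orth_projD:
  assumes "orth_proj m V P"
  shows orth_proj_carrier: "P \<in> carrier_mat m m"
    and orth_proj_subset: "V \<subseteq> carrier_vec m"
    and orth_proj_mem: "v \<in> carrier_vec m \<Longrightarrow> P *\<^sub>v v \<in> V"
    and orth_proj_fix: "x \<in> V \<Longrightarrow> P *\<^sub>v x = x"
proof -
  show P: "P \<in> carrier_mat m m" and mem: "v \<in> carrier_vec m \<Longrightarrow> P *\<^sub>v v \<in> V"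
    and "V \<subseteq> carrier_vec m"
    using assms unfolding orth_proj_def by auto
  have V: "V = {P *\<^sub>v v | v. v \<in> carrier_vec m}"
    using assms by (simp only: orth_proj_def)
  show "P *\<^sub>v x = x" if x: "x \<in> V"
  proof -
    obtain v where v: "v \<in> carrier_vec m" "x = P *\<^sub>v v"
      using x V by blast
    have "P *\<^sub>v (P *\<^sub>v v) = (P * P) *\<^sub>v v"
      using P v by simp
    moreover have "P * P = P"
      using assms by (simp only: orth_proj_def)
    ultimately show ?thesis
      by (simp add: v(2))
  qed
qed

lemma orth_proj_lincomb:
  assumes "orth_proj m V P" "x \<in> V" "y \<in> V"
  shows "c \<cdot>\<^sub>v x + e \<cdot>\<^sub>v y \<in> V"
proof -
  have car: "x \<in> carrier_vec m" "y \<in> carrier_vec m" "P \<in> carrier_mat m m"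
    using orth_projD[OF assms(1)] assms by auto
  have "P *\<^sub>v (c \<cdot>\<^sub>v x + e \<cdot>\<^sub>v y) = c \<cdot>\<^sub>v x + e \<cdot>\<^sub>v y"
    using car orth_proj_fix[OF assms(1)] assms(2,3)
    by (simp add: mult_add_distrib_mat_vec[of _ m m] mult_mat_vec[of _ m m])
  then show ?thesis
    using orth_proj_mem[OF assms(1), of "c \<cdot>\<^sub>v x + e \<cdot>\<^sub>v y"] car by simp
qed

lemma orth_proj_adjoint:
  assumes "orth_proj m V P" "x \<in> carrier_vec m" "y \<in> carrier_vec m"
  shows "(\<Sum>i<m. x $ i * cnj ((P *\<^sub>v y) $ i)) = (\<Sum>j<m. (P *\<^sub>v x) $ j * cnj (y $ j))"
proof -
  have P: "P \<in> carrier_mat m m"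
    using orth_proj_carrier[OF assms(1)] .
  have herm: "cnj (P $$ (i, j)) = P $$ (j, i)" if "i < m" "j < m" for i j
    using assms(1) that unfolding orth_proj_def by metis
  have "x $ i * cnj ((P *\<^sub>v y) $ i) = (\<Sum>j<m. P $$ (j, i) * x $ i * cnj (y $ j))" if "i < m" for i
    unfolding mult_mat_vec_index[OF P assms(3) that] cnj_sum sum_distrib_left
    by (intro sum.cong refl) (simp add: herm[OF that])
  then have "(\<Sum>i<m. x $ i * cnj ((P *\<^sub>v y) $ i)) = (\<Sum>i<m. \<Sum>j<m. P $$ (j, i) * x $ i * cnj (y $ j))"
    by (intro sum.cong) auto
  also have "\<dots> = (\<Sum>j<m. \<Sum>i<m. P $$ (j, i) * x $ i * cnj (y $ j))"
    by (rule sum.swap)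
  also have "\<dots> = (\<Sum>j<m. (P *\<^sub>v x) $ j * cnj (y $ j))"
    by (intro sum.cong refl) (simp only: mult_mat_vec_index[OF P assms(2)] sum_distrib_right lessThan_iff)
  finally show ?thesis .
qed

section \<open>Uniformly bounded oblique projections\<close>

lemma continuous_on_det:
  fixes B :: "'a::topological_space \<Rightarrow> complex mat"
  assumes "\<And>x. B x \<in> carrier_mat n n" "\<And>i j. i < n \<Longrightarrow> j < n \<Longrightarrow> continuous_on S (\<lambda>x. B x $$ (i, j))"
  shows "continuous_on S (\<lambda>x. det (B x))"
proof -
  have "p i < n" if "p permutes {0..<n}" "i < n" for p i
    using permutes_in_image[OF that(1), of i] that(2) by simp
  then show ?thesis
    unfolding det_def'[OF assms(1)]
    by (intro continuous_intros assms(2)) auto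
qed

text \<open>The adjugate stands in for the inverse: its entries are signed minors, hence polynomials
  in the entries of the matrix.\<close>

lemma continuous_on_adj_mat:
  fixes B :: "'a::topological_space \<Rightarrow> complex mat"
  assumes B: "\<And>x. B x \<in> carrier_mat n n"
    and cont: "\<And>i j. i < n \<Longrightarrow> j < n \<Longrightarrow> continuous_on S (\<lambda>x. B x $$ (i, j))"
    and "i < n" "j < n"
  shows "continuous_on S (\<lambda>x. adj_mat (B x) $$ (i, j))"
proof -
  have "continuous_on S (\<lambda>x. det (mat_delete (B x) j i))"
  proof (rule continuous_on_det)
    show "mat_delete (B x) j i \<in> carrier_mat (n - 1) (n - 1)" for x
      by (rule mat_delete_carrier[OF B])
    show "continuous_on S (\<lambda>x. mat_delete (B x) j i $$ (i', j'))" if "i' < n - 1" "j' < n - 1" for i' j'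
    proof -
      have "mat_delete (B x) j i $$ (i', j')
          = B x $$ (if i' < j then i' else Suc i', if j' < i then j' else Suc j')" for x
        using B[of x] that by (simp add: mat_delete_def)
      then show ?thesis
        using that by (auto intro!: cont)
    qed
  qed
  then have "continuous_on S (\<lambda>x. (-1) ^ (j + i) * det (mat_delete (B x) j i))"
    by (intro continuous_intros)
  moreover have "adj_mat (B x) $$ (i, j) = (-1) ^ (j + i) * det (mat_delete (B x) j i)" for x
    using B[of x] assms(3,4) by (simp add: adj_mat_def cofactor_def)
  ultimately show ?thesis
    by simp
qed

text \<open>If \<open>P\<close> and \<open>Q\<close> are the orthogonal projections onto complementary subspaces, then \<open>P + Q\<close> is
  invertible, and \<open>Q (P + Q)\<^sup>-\<^sup>1\<close> is the oblique projection onto the second one along the first.\<close>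
lemma complementary_det_ne_0:
  assumes P: "orth_proj m V P" and Q: "orth_proj m W Q" and "V \<inter> W = {0\<^sub>v m}"
    and sum: "{u + w | u w. u \<in> V \<and> w \<in> W} = carrier_vec m"
  shows "det (P + Q) \<noteq> 0"
proof
  assume "det (P + Q) = 0"
  have car: "P \<in> carrier_mat m m" "Q \<in> carrier_mat m m"
    using orth_projD[OF P] orth_projD[OF Q] by auto
  then obtain x where x: "x \<in> carrier_vec m" "x \<noteq> 0\<^sub>v m" "(P + Q) *\<^sub>v x = 0\<^sub>v m"
    using \<open>det (P + Q) = 0\<close> det_0_iff_vec_prod_zero[of "P + Q" m] by auto
  have PQ: "P *\<^sub>v x + Q *\<^sub>v x = 0\<^sub>v m"
    using x car by (simp add: add_mult_distrib_mat_vec[of _ m m])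
  have PQi: "(P *\<^sub>v x) $ i + (Q *\<^sub>v x) $ i = 0" if "i < m" for i
    using arg_cong[OF PQ, of "\<lambda>v. v $ i"] that car by (simp del: index_mult_mat_vec)
  \<comment> \<open>\<open>P x = - Q x\<close> lies in both subspaces, so both projections of
    \<open>x\<close> vanish. The zero summand only gives the shape that
    \<open>orth_proj_lincomb\<close> expects.\<close>
  have "P *\<^sub>v x = (-1) \<cdot>\<^sub>v (Q *\<^sub>v x) + 0 \<cdot>\<^sub>v (Q *\<^sub>v x)"
    using car PQi by (intro eq_vecI) (auto simp: eq_neg_iff_add_eq_0 simp del: index_mult_mat_vec)
  then have "P *\<^sub>v x \<in> W"
    using orth_proj_lincomb[OF Q, of "Q *\<^sub>v x" "Q *\<^sub>v x" "-1" 0] orth_proj_mem[OF Q x(1)] by simp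
  then have Px: "P *\<^sub>v x = 0\<^sub>v m"
    using orth_proj_mem[OF P x(1)] assms(3) by auto
  then have Qx: "Q *\<^sub>v x = 0\<^sub>v m"
    using PQ car by (intro eq_vecI) (use PQi in \<open>auto simp del: index_mult_mat_vec\<close>)
  obtain u w where uw: "x = u + w" "u \<in> V" "w \<in> W"
    using sum x(1) by blast
  have uwc: "u \<in> carrier_vec m" "w \<in> carrier_vec m"
    using uw orth_proj_subset[OF P] orth_proj_subset[OF Q] by auto
  \<comment> \<open>With \<open>x = u + w\<close>, \<open>u = P u\<close> and
    \<open>w = Q w\<close>, moving the self-adjoint \<open>P\<close> and \<open>Q\<close> to the
    other side shows that \<open>x\<close> is orthogonal to itself.\<close>
  have "(\<Sum>i<m. x $ i * cnj (x $ i)) = (\<Sum>i<m. x $ i * cnj ((P *\<^sub>v u) $ i)) + (\<Sum>i<m. x $ i * cnj ((Q *\<^sub>v w) $ i))"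
    unfolding orth_proj_fix[OF P uw(2)] orth_proj_fix[OF Q uw(3)] sum.distrib[symmetric]
    using uwc by (intro sum.cong refl) (simp add: uw(1) algebra_simps)
  also have "\<dots> = 0"
    unfolding orth_proj_adjoint[OF P x(1) uwc(1)] orth_proj_adjoint[OF Q x(1) uwc(2)] Px Qx by simp
  finally have 0: "(\<Sum>i<m. x $ i * cnj (x $ i)) = 0" .
  have "x $ i = 0" if "i < m" for i
    by (rule sum_mult_cnj_eq_0[OF _ 0]) (use that in auto)
  then show False
    using x(1,2) by (metis carrier_vecD eq_vecI index_zero_vec)
qed

text \<open>With \<open>x\<close> the adjugate applied to \<open>u + w\<close> and
  \<open>\<delta>\<close> the determinant, \<open>P x + Q x = \<delta> (u + w)\<close>. Hence
  \<open>P x - \<delta> u = \<delta> w - Q x\<close> lies in both subspaces and is zero.\<close>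

lemma complementary_projection:
  assumes P: "orth_proj m V P" and Q: "orth_proj m W Q" and "V \<inter> W = {0\<^sub>v m}"
    and sum: "{u + w | u w. u \<in> V \<and> w \<in> W} = carrier_vec m"
    and uw: "u \<in> V" "w \<in> W"
  shows "det (P + Q) \<cdot>\<^sub>v w = (Q * adj_mat (P + Q)) *\<^sub>v (u + w)"
proof -
  define \<delta> where "\<delta> = det (P + Q)"
  define x where "x = adj_mat (P + Q) *\<^sub>v (u + w)"
  have car: "P \<in> carrier_mat m m" "Q \<in> carrier_mat m m"
    using orth_projD[OF P] orth_projD[OF Q] by auto
  have uwc: "u \<in> carrier_vec m" "w \<in> carrier_vec m"
    using uw orth_proj_subset[OF P] orth_proj_subset[OF Q] by auto
  have adj: "adj_mat (P + Q) \<in> carrier_mat m m" "(P + Q) * adj_mat (P + Q) = \<delta> \<cdot>\<^sub>m 1\<^sub>m m"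
    using adj_mat[of "P + Q" m] car by (auto simp: \<delta>_def)
  have x: "x \<in> carrier_vec m"
    using adj uwc by (simp add: x_def)
  have "(P + Q) *\<^sub>v x = ((P + Q) * adj_mat (P + Q)) *\<^sub>v (u + w)"
    unfolding x_def using car adj(1) uwc by (intro assoc_mult_mat_vec[symmetric]) auto
  also have "\<dots> = \<delta> \<cdot>\<^sub>v (u + w)"
    unfolding adj(2) using uwc by (intro eq_vecI) auto
  finally have eq: "P *\<^sub>v x + Q *\<^sub>v x = \<delta> \<cdot>\<^sub>v (u + w)"
    using x car by (simp add: add_mult_distrib_mat_vec[of _ m m])
  have eqi: "(P *\<^sub>v x) $ i + (Q *\<^sub>v x) $ i = \<delta> * (u $ i + w $ i)" if "i < m" for i
    using arg_cong[OF eq, of "\<lambda>v. v $ i"] that car uwc by (simp del: index_mult_mat_vec)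
  have "1 \<cdot>\<^sub>v (P *\<^sub>v x) + (- \<delta>) \<cdot>\<^sub>v u = \<delta> \<cdot>\<^sub>v w + (- 1) \<cdot>\<^sub>v (Q *\<^sub>v x)"
  proof (rule eq_vecI)
    fix i assume "i < dim_vec (\<delta> \<cdot>\<^sub>v w + (- 1) \<cdot>\<^sub>v (Q *\<^sub>v x))"
    then have "i < m" using car by simp
    then show "(1 \<cdot>\<^sub>v (P *\<^sub>v x) + (- \<delta>) \<cdot>\<^sub>v u) $ i = (\<delta> \<cdot>\<^sub>v w + (- 1) \<cdot>\<^sub>v (Q *\<^sub>v x)) $ i"
      using eqi[of i] car uwc by (simp add: algebra_simps del: index_mult_mat_vec)
  qed (use car uwc in simp)
  moreover have "1 \<cdot>\<^sub>v (P *\<^sub>v x) + (- \<delta>) \<cdot>\<^sub>v u \<in> V"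
    by (intro orth_proj_lincomb[OF P] orth_proj_mem[OF P] x uw)
  moreover have "\<delta> \<cdot>\<^sub>v w + (- 1) \<cdot>\<^sub>v (Q *\<^sub>v x) \<in> W"
    by (intro orth_proj_lincomb[OF Q] orth_proj_mem[OF Q] x uw)
  ultimately have z: "\<delta> \<cdot>\<^sub>v w + (- 1) \<cdot>\<^sub>v (Q *\<^sub>v x) = 0\<^sub>v m"
    using assms(3) by auto
  have "\<delta> \<cdot>\<^sub>v w = Q *\<^sub>v x"
  proof (rule eq_vecI)
    fix i assume "i < dim_vec (Q *\<^sub>v x)"
    then have "i < m" using car by simp
    then show "(\<delta> \<cdot>\<^sub>v w) $ i = (Q *\<^sub>v x) $ i"
      using arg_cong[OF z, of "\<lambda>v. v $ i"] car uwc by (simp del: index_mult_mat_vec)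
  qed (use car uwc in simp)
  also have "\<dots> = (Q * adj_mat (P + Q)) *\<^sub>v (u + w)"
    unfolding x_def using car adj(1) uwc by (intro assoc_mult_mat_vec[symmetric]) auto
  finally show ?thesis
    by (simp add: \<delta>_def)
qed

text \<open>The matrix entries of the oblique projection are continuous in the base point, hence
  bounded on the compact base. One \<open>K\<close> for all points is essential, since it is applied
  along a whole backward orbit.\<close>

lemma complementary_projection_bounded:
  fixes V W :: "'a::topological_space \<Rightarrow> complex vec set"
  assumes "compact (UNIV :: 'a set)" "continuous_subspaces m V" "continuous_subspaces m W"
    and disj: "\<And>x. V x \<inter> W x = {0\<^sub>v m}"
    and sum: "\<And>x. {u + w | u w. u \<in> V x \<and> w \<in> W x} = carrier_vec m"
  shows "\<exists>K. \<forall>x. \<forall>u\<in>V x. \<forall>w\<in>W x. \<forall>i<m. cmod (w $ i) \<le> K * (\<Sum>j<m. cmod ((u + w) $ j))"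
proof -
  obtain P where P: "\<And>x. orth_proj m (V x) (P x)"
    and Pc: "\<And>i j. i < m \<Longrightarrow> j < m \<Longrightarrow> continuous_on UNIV (\<lambda>x. P x $$ (i, j))"
    using assms(2) by (auto simp: continuous_subspaces_def)
  obtain Q where Q: "\<And>x. orth_proj m (W x) (Q x)"
    and Qc: "\<And>i j. i < m \<Longrightarrow> j < m \<Longrightarrow> continuous_on UNIV (\<lambda>x. Q x $$ (i, j))"
    using assms(3) by (auto simp: continuous_subspaces_def)
  have car: "P x \<in> carrier_mat m m" "Q x \<in> carrier_mat m m" for x
    using orth_proj_carrier[OF P] orth_proj_carrier[OF Q] by auto
  define S where "S x = P x + Q x" for x
  have S: "S x \<in> carrier_mat m m" for x
    using car by (simp add: S_def)
  have adj: "adj_mat (S x) \<in> carrier_mat m m" for x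
    using adj_mat[OF S] by simp
  have Sc: "continuous_on UNIV (\<lambda>x. S x $$ (i, j))" if "i < m" "j < m" for i j
  proof -
    have "S x $$ (i, j) = P x $$ (i, j) + Q x $$ (i, j)" for x
      using that car[of x] by (simp add: S_def)
    then show ?thesis
      using Pc[OF that] Qc[OF that] by (simp add: continuous_on_add)
  qed
  have det: "det (S x) \<noteq> 0" for x
    unfolding S_def by (rule complementary_det_ne_0[OF P Q disj sum])
  define B where "B x i j = (Q x * adj_mat (S x)) $$ (i, j) / det (S x)" for x i j
  have B: "w $ i = (\<Sum>j<m. B x i j * (u + w) $ j)" if "u \<in> V x" "w \<in> W x" "i < m" for x u w i
  proof -
    have uwc: "u \<in> carrier_vec m" "w \<in> carrier_vec m"
      using that orth_proj_subset[OF P] orth_proj_subset[OF Q] by auto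
    have "det (S x) * w $ i = (det (S x) \<cdot>\<^sub>v w) $ i"
      using uwc that(3) by simp
    also have "\<dots> = ((Q x * adj_mat (S x)) *\<^sub>v (u + w)) $ i"
      unfolding S_def complementary_projection[OF P Q disj sum that(1,2)] ..
    also have "\<dots> = (\<Sum>j<m. (Q x * adj_mat (S x)) $$ (i, j) * (u + w) $ j)"
      using that(3) car[of x] adj[of x] uwc
      by (subst mult_mat_vec_index[of _ m m]) simp_all
    finally have "w $ i = (\<Sum>j<m. (Q x * adj_mat (S x)) $$ (i, j) * (u + w) $ j) / det (S x)"
      using det[of x] by (simp add: field_simps)
    then show ?thesis
      by (simp add: B_def sum_divide_distrib)
  qed
  have Bc: "continuous_on UNIV (\<lambda>x. B x i j)" if "i < m" "j < m" for i j
  proof -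
    have "(Q x * adj_mat (S x)) $$ (i, j) = (\<Sum>k<m. Q x $$ (i, k) * adj_mat (S x) $$ (k, j))" for x
      using that car[of x] adj[of x] by (simp add: scalar_prod_def atLeast0LessThan)
    moreover have "continuous_on UNIV (\<lambda>x. \<Sum>k<m. Q x $$ (i, k) * adj_mat (S x) $$ (k, j))"
      by (intro continuous_intros Qc continuous_on_adj_mat[OF S Sc]) (use that in auto)
    moreover have "continuous_on UNIV (\<lambda>x. det (S x))"
      by (rule continuous_on_det[OF S Sc])
    ultimately show ?thesis
      unfolding B_def by (auto intro!: continuous_on_divide simp: det)
  qed
  have "\<exists>K. \<forall>x. cmod (B x i j) \<le> K" if "i < m" "j < m" for i j
    using compact_imp_bounded[OF compact_continuous_image[OF Bc[OF that] assms(1)]]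
    by (auto simp: bounded_iff)
  then obtain K where K: "\<And>i j x. i < m \<Longrightarrow> j < m \<Longrightarrow> cmod (B x i j) \<le> K i j"
    by metis
  define L where "L = (\<Sum>i<m. \<Sum>j<m. \<bar>K i j\<bar>)"
  have L: "cmod (B x i j) \<le> L" if "i < m" "j < m" for x i j
  proof -
    have "cmod (B x i j) \<le> \<bar>K i j\<bar>"
      using K[OF that, of x] by linarith
    also have "\<dots> \<le> (\<Sum>j<m. \<bar>K i j\<bar>)"
      using that by (intro member_le_sum) auto
    also have "\<dots> \<le> L"
      unfolding L_def using that by (intro member_le_sum[of i _ "\<lambda>i. \<Sum>j<m. \<bar>K i j\<bar>"]) (auto simp: sum_nonneg)
    finally show ?thesis .
  qed
  have "cmod (w $ i) \<le> L * (\<Sum>j<m. cmod ((u + w) $ j))" if "u \<in> V x" "w \<in> W x" "i < m" for x u w i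
    unfolding B[OF that] sum_distrib_left
    by (rule order_trans[OF norm_sum], rule sum_mono) (auto simp: norm_mult intro!: mult_right_mono L that)
  then show ?thesis
    by blast
qed

section \<open>Dominated splittings\<close>

lemma cocycle_iter_carrier:
  assumes "\<And>x. A x \<in> carrier_mat m m"
  shows "cocycle_iter m T A n x \<in> carrier_mat m m"
  by (induction n) (auto intro: mult_carrier_mat[OF assms])

lemma cocycle_iter_add:
  assumes A: "\<And>x. A x \<in> carrier_mat m m"
  shows "cocycle_iter m T A (n + k) x = cocycle_iter m T A n ((T ^^ k) x) * cocycle_iter m T A k x"
proof (induction n)
  case 0
  then show ?case
    using cocycle_iter_carrier[of A m T k x] A by simp
next
  case (Suc n)
  then show ?case
    by (simp add: funpow_add assoc_mult_mat[of _ m m _ m _ m] A cocycle_iter_carrier)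
qed

lemma cocycle_iter_Suc_apply:
  assumes "\<And>x. A x \<in> carrier_mat m m" "v \<in> carrier_vec m"
  shows "cocycle_iter m T A (Suc n) x *\<^sub>v v = A ((T ^^ n) x) *\<^sub>v (cocycle_iter m T A n x *\<^sub>v v)"
  using assoc_mult_mat_vec[OF assms(1) cocycle_iter_carrier[OF assms(1)] assms(2)] by simp

lemma cocycle_iter_image:
  assumes A: "\<And>x. A x \<in> carrier_mat m m" and V: "\<And>x. V x \<subseteq> carrier_vec m"
    and image: "\<And>x. (\<lambda>v. A x *\<^sub>v v) ` V x = V (T x)"
  shows "(\<lambda>v. cocycle_iter m T A n x *\<^sub>v v) ` V x = V ((T ^^ n) x)"
proof (induction n)
  case 0
  have "(\<lambda>v. 1\<^sub>m m *\<^sub>v v) ` V x = (\<lambda>v. v) ` V x"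
    using V[of x] by (intro image_cong) auto
  then show ?case by simp
next
  case (Suc n)
  have "(\<lambda>v. cocycle_iter m T A (Suc n) x *\<^sub>v v) ` V x
      = (\<lambda>v. A ((T ^^ n) x) *\<^sub>v v) ` (\<lambda>v. cocycle_iter m T A n x *\<^sub>v v) ` V x"
    unfolding image_image using V[of x]
    by (intro image_cong refl cocycle_iter_Suc_apply[OF A]) auto
  then show ?case
    by (simp only: Suc image) simp
qed

locale dominated_splitting =
  fixes T :: "'a::topological_space \<Rightarrow> 'a" and m :: nat and A :: "'a \<Rightarrow> complex mat"
    and Ep Em :: "'a \<Rightarrow> complex vec set" and N :: nat
  assumes A_carrier: "A x \<in> carrier_mat m m"
    and continuous_Ep: "continuous_subspaces m Ep" and continuous_Em: "continuous_subspaces m Em"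
    and disjoint: "Ep x \<inter> Em x = {0\<^sub>v m}"
    and sum_eq: "{u + w | u w. u \<in> Ep x \<and> w \<in> Em x} = carrier_vec m"
    and image_Ep: "(\<lambda>v. A x *\<^sub>v v) ` Ep x = Ep (T x)"
    and image_Em: "(\<lambda>v. A x *\<^sub>v v) ` Em x = Em (T x)"
    and N_pos: "1 \<le> N"
    and dominates: "\<lbrakk>u \<in> Ep x; w \<in> Em x; vnorm u = 1; vnorm w = 1\<rbrakk>
      \<Longrightarrow> vnorm (cocycle_iter m T A N x *\<^sub>v w) < vnorm (cocycle_iter m T A N x *\<^sub>v u)"
begin

abbreviation C where "C \<equiv> cocycle_iter m T A"

lemma lincomb_closed:
  shows Ep_lincomb: "\<lbrakk>u \<in> Ep x; v \<in> Ep x\<rbrakk> \<Longrightarrow> c \<cdot>\<^sub>v u + e \<cdot>\<^sub>v v \<in> Ep x"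
    and Em_lincomb: "\<lbrakk>u \<in> Em x; v \<in> Em x\<rbrakk> \<Longrightarrow> c \<cdot>\<^sub>v u + e \<cdot>\<^sub>v v \<in> Em x"
  using continuous_Ep continuous_Em orth_proj_lincomb unfolding continuous_subspaces_def by metis+

lemma subset_carrier:
  shows Ep_subset: "Ep x \<subseteq> carrier_vec m" and Em_subset: "Em x \<subseteq> carrier_vec m"
  using continuous_Ep continuous_Em orth_proj_subset unfolding continuous_subspaces_def by metis+

lemma Ep_smult: "u \<in> Ep x \<Longrightarrow> c \<cdot>\<^sub>v u \<in> Ep x"
  and Em_smult: "u \<in> Em x \<Longrightarrow> c \<cdot>\<^sub>v u \<in> Em x"
proof -
  have "c \<cdot>\<^sub>v u + 0 \<cdot>\<^sub>v u = c \<cdot>\<^sub>v u"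
    by (intro eq_vecI) auto
  then show "u \<in> Ep x \<Longrightarrow> c \<cdot>\<^sub>v u \<in> Ep x" and "u \<in> Em x \<Longrightarrow> c \<cdot>\<^sub>v u \<in> Em x"
    using Ep_lincomb[of u x u c 0] Em_lincomb[of u x u c 0] by simp_all
qed

lemma C_carrier: "C n x \<in> carrier_mat m m"
  by (rule cocycle_iter_carrier) (rule A_carrier)

lemma vnorm_C_zero: "vnorm (C n x *\<^sub>v 0\<^sub>v m) = 0"
proof -
  have "C n x *\<^sub>v 0\<^sub>v m = 0\<^sub>v m"
    using C_carrier[of n x] by (intro eq_vecI) auto
  then show ?thesis
    by (simp add: vnorm_def)
qed

lemma C_image_Ep: "(\<lambda>v. C n x *\<^sub>v v) ` Ep x = Ep ((T ^^ n) x)"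
  and C_image_Em: "(\<lambda>v. C n x *\<^sub>v v) ` Em x = Em ((T ^^ n) x)"
  by (intro cocycle_iter_image A_carrier Ep_subset Em_subset image_Ep image_Em)+

text \<open>Homogeneous, cross-multiplied form of domination; giving up strictness admits zero
  vectors.\<close>

lemma dominates_N:
  assumes "u \<in> Ep x" "w \<in> Em x"
  shows "vnorm (C N x *\<^sub>v w) * vnorm u \<le> vnorm (C N x *\<^sub>v u) * vnorm w"
proof (cases "vnorm u = 0 \<or> vnorm w = 0")
  case True
  moreover have "w \<in> carrier_vec m"
    using assms Em_subset by auto
  ultimately show ?thesis
    using vnorm_eq_0_iff[of w m] by (auto simp: vnorm_nonneg vnorm_C_zero)
next
  case False
  define r s where "r = vnorm u" and "s = vnorm w"
  have pos: "0 < r" "0 < s"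
    using False vnorm_nonneg[of u] vnorm_nonneg[of w] by (auto simp: r_def s_def)
  have car: "u \<in> carrier_vec m" "w \<in> carrier_vec m"
    using assms Ep_subset Em_subset by auto
  have "vnorm (C N x *\<^sub>v (of_real (1 / s) \<cdot>\<^sub>v w)) < vnorm (C N x *\<^sub>v (of_real (1 / r) \<cdot>\<^sub>v u))"
    using pos by (intro dominates Ep_smult Em_smult assms) (auto simp: vnorm_smult norm_divide r_def s_def)
  then have "vnorm (C N x *\<^sub>v w) / s < vnorm (C N x *\<^sub>v u) / r"
    using car pos by (simp add: mult_mat_vec[OF C_carrier] vnorm_smult norm_divide)
  then have "vnorm (C N x *\<^sub>v w) * r < vnorm (C N x *\<^sub>v u) * s"
    using pos by (simp add: field_simps)
  then show ?thesis
    by (simp add: r_def s_def)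
qed

text \<open>By invariance the images after \<open>k * N\<close> steps again lie in the two subspaces
  over the new base point, so the inequalities for successive blocks of length \<open>N\<close>
  multiply.\<close>

lemma dominates_multiple:
  assumes "u \<in> Ep x" "w \<in> Em x"
  shows "vnorm (C (k * N) x *\<^sub>v w) * vnorm u \<le> vnorm (C (k * N) x *\<^sub>v u) * vnorm w"
proof (induction k)
  case 0
  have "u \<in> carrier_vec m" "w \<in> carrier_vec m"
    using assms Ep_subset Em_subset by auto
  then show ?case by simp
next
  case (Suc k)
  define u' w' where "u' = C (k * N) x *\<^sub>v u" and "w' = C (k * N) x *\<^sub>v w"
  define y where "y = (T ^^ (k * N)) x"
  have car: "u \<in> carrier_vec m" "w \<in> carrier_vec m"
    using assms Ep_subset Em_subset by auto
  have mem: "u' \<in> Ep y" "w' \<in> Em y"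
    using C_image_Ep[of "k * N" x] C_image_Em[of "k * N" x] assms by (auto simp: u'_def w'_def y_def)
  have step: "C (Suc k * N) x *\<^sub>v v = C N y *\<^sub>v (C (k * N) x *\<^sub>v v)" if "v \<in> carrier_vec m" for v
    using cocycle_iter_add[of A m T N "k * N" x] A_carrier C_carrier that
    by (simp add: y_def assoc_mult_mat_vec[of _ m m _ m])
  define a b where "a = vnorm (C N y *\<^sub>v w')" and "b = vnorm (C N y *\<^sub>v u')"
  have IH: "vnorm w' * vnorm u \<le> vnorm u' * vnorm w"
    using Suc by (simp add: u'_def w'_def)
  have ab: "a * vnorm u' \<le> b * vnorm w'"
    unfolding a_def b_def by (rule dominates_N[OF mem])
  have nonneg: "0 \<le> a" "0 \<le> b" "0 \<le> vnorm u" "0 \<le> vnorm w" "0 \<le> vnorm u'" "0 \<le> vnorm w'"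
    by (auto simp: a_def b_def vnorm_nonneg)
  have "a * vnorm u \<le> b * vnorm w"
  proof (cases "vnorm w' = 0")
    case True
    then have "w' = 0\<^sub>v m"
      using mem(2) Em_subset vnorm_eq_0_iff by blast
    then have "a = 0"
      by (simp add: a_def vnorm_C_zero)
    then show ?thesis using nonneg by simp
  next
    case w': False
    show ?thesis
    proof (cases "vnorm u' = 0")
      case True
      \<comment> \<open>The matrices are not assumed invertible here, so \<open>u'\<close> may
        vanish; the induction hypothesis then forces \<open>u\<close> itself to vanish.\<close>
      then have "vnorm u = 0"
        using IH w' nonneg by (simp add: mult_le_0_iff)
      then show ?thesis using nonneg by simp
    next
      case False
      have "(a * vnorm u) * (vnorm u' * vnorm w') = (a * vnorm u') * (vnorm w' * vnorm u)"
        by simp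
      also have "\<dots> \<le> (b * vnorm w') * (vnorm u' * vnorm w)"
        by (intro mult_mono ab IH mult_nonneg_nonneg nonneg)
      also have "\<dots> = (b * vnorm w) * (vnorm u' * vnorm w')"
        by simp
      finally show ?thesis
        using False w' nonneg by (simp add: mult_le_cancel_right)
    qed
  qed
  then show ?case
    by (simp only: step[OF car(1)] step[OF car(2)] a_def b_def u'_def w'_def)
qed

text \<open>A single nonzero decaying vector of \<open>Ep\<close> serves as a yardstick for all of
  \<open>Em\<close>.\<close>

lemma forward_decay:
  assumes "u \<in> Ep x" "u \<noteq> 0\<^sub>v m" "w \<in> Em x"
    and "(\<lambda>k. vnorm (C (k * N) x *\<^sub>v u)) \<longlonglongrightarrow> 0"
  shows "(\<lambda>k. vnorm (C (k * N) x *\<^sub>v w)) \<longlonglongrightarrow> 0"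
proof -
  have "vnorm u \<noteq> 0"
    using assms(1,2) Ep_subset vnorm_eq_0_iff by blast
  then have pos: "0 < vnorm u"
    using vnorm_nonneg[of u] by simp
  have lim: "(\<lambda>k. vnorm (C (k * N) x *\<^sub>v u) * (vnorm w / vnorm u)) \<longlonglongrightarrow> 0"
    using tendsto_mult_right[OF assms(4), of "vnorm w / vnorm u"] by simp
  show ?thesis
    by (rule tendsto_sandwich[OF _ _ tendsto_const lim])
       (use dominates_multiple[OF assms(1,3)] pos in \<open>auto simp: vnorm_nonneg field_simps\<close>)
qed

text \<open>A backward decaying orbit outside \<open>Ep\<close> has a nonzero component in \<open>Em\<close>, which decays as well
  since the oblique projections are uniformly bounded; every orbit in \<open>Ep\<close> decays even faster.\<close>
lemma backward_decay:
  assumes compact: "compact (UNIV :: 'a set)"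
    and base: "\<And>k. (T ^^ (k * N)) (y k) = x"
    and v: "\<And>k. v k \<in> carrier_vec m" "\<And>k. C (k * N) (y k) *\<^sub>v v k = v0" "v0 \<notin> Ep x"
    and lim: "(\<lambda>k. vnorm (v k)) \<longlonglongrightarrow> 0" and "p \<in> Ep x"
  shows "\<exists>q. (\<forall>k. q k \<in> carrier_vec m \<and> C (k * N) (y k) *\<^sub>v q k = p) \<and> (\<lambda>k. vnorm (q k)) \<longlonglongrightarrow> 0"
proof -
  obtain K where K: "\<And>x u w i. \<lbrakk>u \<in> Ep x; w \<in> Em x; i < m\<rbrakk> \<Longrightarrow> cmod (w $ i) \<le> K * (\<Sum>j<m. cmod ((u + w) $ j))"
    using complementary_projection_bounded[OF compact continuous_Ep continuous_Em disjoint sum_eq] by blast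
  have "\<exists>u w. v k = u + w \<and> u \<in> Ep (y k) \<and> w \<in> Em (y k)" for k
    using v(1)[of k] sum_eq[of "y k"] by blast
  then obtain u w where uw: "\<And>k. v k = u k + w k" "\<And>k. u k \<in> Ep (y k)" "\<And>k. w k \<in> Em (y k)"
    by metis
  have car: "u k \<in> carrier_vec m" "w k \<in> carrier_vec m" for k
    using uw Ep_subset Em_subset by blast+
  define u0 w0 where "u0 = C (0 * N) (y 0) *\<^sub>v u 0" and "w0 = C (0 * N) (y 0) *\<^sub>v w 0"
  have mem: "C (k * N) (y k) *\<^sub>v u k \<in> Ep x" "C (k * N) (y k) *\<^sub>v w k \<in> Em x" for k
    using C_image_Ep[of "k * N" "y k"] C_image_Em[of "k * N" "y k"] uw base[of k] by blast+
  have sum: "C (k * N) (y k) *\<^sub>v u k + C (k * N) (y k) *\<^sub>v w k = v0" for k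
    using v(2)[of k] mult_add_distrib_mat_vec[OF C_carrier car(1) car(2)] by (simp add: uw(1))
  \<comment> \<open>The components of \<open>v k\<close> are transported to components of the fixed
    vector \<open>v0\<close> at \<open>x\<close>; uniqueness of its decomposition makes them
    independent of \<open>k\<close>.\<close>
  have w0: "C (k * N) (y k) *\<^sub>v w k = w0" for k
  proof -
    define uk wk where "uk = C (k * N) (y k) *\<^sub>v u k" and "wk = C (k * N) (y k) *\<^sub>v w k"
    have mem': "uk \<in> Ep x" "wk \<in> Em x" "u0 \<in> Ep x" "w0 \<in> Em x"
      using mem[of k] mem[of 0] by (auto simp: uk_def wk_def u0_def w0_def)
    have car': "uk \<in> carrier_vec m" "wk \<in> carrier_vec m" "u0 \<in> carrier_vec m" "w0 \<in> carrier_vec m"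
      using mem' Ep_subset Em_subset by blast+
    have "uk + wk = u0 + w0"
      using sum[of k] sum[of 0] by (simp add: uk_def wk_def u0_def w0_def)
    from arg_cong[OF this, of "\<lambda>v. v $ i" for i]
    have i: "uk $ i + wk $ i = u0 $ i + w0 $ i" if "i < m" for i
      using car' that by (metis carrier_vecD index_add_vec(1))
    have "1 \<cdot>\<^sub>v uk + (-1) \<cdot>\<^sub>v u0 = 1 \<cdot>\<^sub>v w0 + (-1) \<cdot>\<^sub>v wk"
      using car' i by (intro eq_vecI) (auto simp: algebra_simps)
    then have "1 \<cdot>\<^sub>v w0 + (-1) \<cdot>\<^sub>v wk \<in> Ep x \<inter> Em x"
      using Ep_lincomb[OF mem'(1,3), of 1 "-1"] Em_lincomb[OF mem'(4,2), of 1 "-1"] by simp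
    then have z: "1 \<cdot>\<^sub>v w0 + (-1) \<cdot>\<^sub>v wk = 0\<^sub>v m"
      using disjoint by auto
    have "wk $ i = w0 $ i" if "i < m" for i
      using arg_cong[OF z, of "\<lambda>v. v $ i"] car' that by simp
    then show ?thesis
      using car' unfolding wk_def[symmetric] by (intro eq_vecI) auto
  qed
  have "w0 \<noteq> 0\<^sub>v m"
  proof
    assume "w0 = 0\<^sub>v m"
    then have "v0 = u0"
      using sum[of 0] mem(1)[of 0] Ep_subset[of x] by (auto simp: u0_def w0_def)
    then show False
      using v(3) mem(1)[of 0] by (simp add: u0_def)
  qed
  moreover have "w0 \<in> carrier_vec m"
    using mem(2)[of 0] Em_subset by (auto simp: w0_def)
  ultimately have pos: "0 < vnorm w0"
    using vnorm_eq_0_iff[of w0 m] vnorm_nonneg[of w0] by simp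
  have vi: "(\<lambda>k. v k $ i) \<longlonglongrightarrow> 0" if "i < m" for i
    using lim that by (simp add: vnorm_tendsto_0_iff[of v m] v(1))
  have "(\<lambda>k. vnorm (w k)) \<longlonglongrightarrow> 0"
    unfolding vnorm_tendsto_0_iff[of w m, OF car(2)]
  proof (intro allI impI)
    fix i assume i: "i < m"
    have "(\<lambda>k. K * (\<Sum>j<m. cmod (v k $ j))) \<longlonglongrightarrow> K * (\<Sum>j<m. 0)"
      by (intro tendsto_intros tendsto_norm_zero vi) auto
    then have "(\<lambda>k. K * (\<Sum>j<m. cmod (v k $ j))) \<longlonglongrightarrow> 0"
      by simp
    then show "(\<lambda>k. w k $ i) \<longlonglongrightarrow> 0"
      by (rule Lim_null_comparison[rotated]) (use K[OF uw(2,3) i] uw(1) in simp)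
  qed
  then have lim': "(\<lambda>k. vnorm (w k) * (vnorm p / vnorm w0)) \<longlonglongrightarrow> 0"
    using tendsto_mult_right[of "\<lambda>k. vnorm (w k)" 0 sequentially "vnorm p / vnorm w0"] by simp
  \<comment> \<open>Invariance is an equality of images, so \<open>p\<close> has preimages inside
    \<open>Ep\<close> along the backward orbit.\<close>
  have "\<exists>q. q \<in> Ep (y k) \<and> C (k * N) (y k) *\<^sub>v q = p" for k
  proof -
    have "p \<in> (\<lambda>v. C (k * N) (y k) *\<^sub>v v) ` Ep (y k)"
      unfolding C_image_Ep base by (rule \<open>p \<in> Ep x\<close>)
    then show ?thesis by blast
  qed
  then obtain q where q: "\<And>k. q k \<in> Ep (y k)" "\<And>k. C (k * N) (y k) *\<^sub>v q k = p"
    by metis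
  have "(\<lambda>k. vnorm (q k)) \<longlonglongrightarrow> 0"
  proof (rule tendsto_sandwich[OF _ _ tendsto_const lim'])
    \<comment> \<open>Domination from \<open>y k\<close> to \<open>x\<close>, where the endpoints
      \<open>p\<close> and \<open>w0\<close> are fixed: a small initial vector \<open>w k\<close>
      forces a small \<open>q k\<close>.\<close>
    have "vnorm w0 * vnorm (q k) \<le> vnorm p * vnorm (w k)" for k
      using dominates_multiple[OF q(1) uw(3), of k k] by (simp add: q(2) w0)
    then show "\<forall>\<^sub>F k in sequentially. vnorm (q k) \<le> vnorm (w k) * (vnorm p / vnorm w0)"
      using pos by (simp add: field_simps)
  qed (simp add: vnorm_nonneg)
  then show ?thesis
    using q Ep_subset by blast
qed

end

lemma dominated_obtains_splitting:
  assumes "\<And>x. A x \<in> carrier_mat m m" "dominated T m A k"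
  obtains Ep Em N where "dominated_splitting T m A Ep Em N"
    "\<forall>x. subspace_dim m (Ep x) k \<and> (\<exists>k'. subspace_dim m (Em x) k')"
  using assms(2) unfolding dominated_def
proof (elim exE conjE)
  fix Ep Em N
  assume *: "continuous_subspaces m Ep" "continuous_subspaces m Em"
    "\<forall>x. subspace_dim m (Ep x) k \<and> (\<exists>k'. subspace_dim m (Em x) k')"
    "\<forall>x. Ep x \<inter> Em x = {0\<^sub>v m} \<and> {u + w | u w. u \<in> Ep x \<and> w \<in> Em x} = carrier_vec m"
    "\<forall>x. (\<lambda>v. A x *\<^sub>v v) ` Ep x = Ep (T x) \<and> (\<lambda>v. A x *\<^sub>v v) ` Em x = Em (T x)"
    "1 \<le> N" "\<forall>x u w. u \<in> Ep x \<and> w \<in> Em x \<and> vnorm u = 1 \<and> vnorm w = 1 \<longrightarrow>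
        vnorm (cocycle_iter m T A N x *\<^sub>v u) > vnorm (cocycle_iter m T A N x *\<^sub>v w)"
  have "dominated_splitting T m A Ep Em N"
    by unfold_locales (simp_all only: assms(1) * not_False_eq_True simp_thms)
  then show thesis
    using *(3) by (rule that)
qed

section \<open>The transfer cocycle\<close>

lemma transfer_carrier: "transfer a d f E \<omega> \<in> carrier_mat (2 * d) (2 * d)"
  by (simp add: transfer_def)

lemma transfer_mult_Suc:
  assumes "x \<in> carrier_vec (2 * d)" "Suc i < 2 * d"
  shows "(transfer a d f E \<omega> *\<^sub>v x) $ Suc i = x $ i"
proof -
  have "(transfer a d f E \<omega> *\<^sub>v x) $ Suc i = (\<Sum>j<2*d. (if j = i then 1 else 0) * x $ j)"
    unfolding mult_mat_vec_index[OF transfer_carrier assms] using assms(2)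
    by (intro sum.cong refl) (simp add: transfer_def)
  also have "\<dots> = x $ i"
    using assms(2) by (simp add: if_distrib[of "\<lambda>x. x * _"] cong: if_cong)
  finally show ?thesis .
qed

lemma transfer_mult_0:
  assumes "x \<in> carrier_vec (2 * d)" "1 \<le> d"
  shows "(transfer a d f E \<omega> *\<^sub>v x) $ 0 =
    ((E - of_real (f \<omega>)) * x $ (d - 1) - (\<Sum>j<2*d. of_real (a (int d - 1 - int j)) * x $ j)) / of_real (a (int d))"
proof -
  have "(transfer a d f E \<omega> *\<^sub>v x) $ 0 = (\<Sum>j<2*d. ((if j = d - 1 then E - of_real (f \<omega>) else 0)
          - of_real (a (int d - 1 - int j))) / of_real (a (int d)) * x $ j)"
    using assms(2) by (subst mult_mat_vec_index[OF transfer_carrier assms(1)])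
      (auto simp: transfer_def intro!: sum.cong)
  also have "\<dots> = (\<Sum>j<2*d. ((if j = d - 1 then (E - of_real (f \<omega>)) * x $ j else 0)
          - of_real (a (int d - 1 - int j)) * x $ j) / of_real (a (int d)))"
    by (intro sum.cong refl) (auto simp: algebra_simps)
  also have "\<dots> = ((\<Sum>j<2*d. if j = d - 1 then (E - of_real (f \<omega>)) * x $ j else 0)
          - (\<Sum>j<2*d. of_real (a (int d - 1 - int j)) * x $ j)) / of_real (a (int d))"
    by (simp only: sum_divide_distrib[symmetric] sum_subtractf)
  also have "(\<Sum>j<2*d. if j = d - 1 then (E - of_real (f \<omega>)) * x $ j else 0) = (E - of_real (f \<omega>)) * x $ (d - 1)"
  proof -
    have "d - 1 < 2 * d" using assms(2) by linarith
    then show ?thesis by simp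
  qed
  finally show ?thesis .
qed

text \<open>\<open>X\<close> lists \<open>2 * d + 1\<close> consecutive values around the centre
  \<open>X d\<close>. The lower rows merely shift; the first row is the difference equation at the
  centre, solved for \<open>X 0\<close>.\<close>

lemma transfer_mult_eq_iff:
  assumes "1 \<le> d" "a (int d) \<noteq> 0"
  shows "transfer a d f E \<omega> *\<^sub>v vec (2 * d) (\<lambda>i. X (Suc i)) = vec (2 * d) X \<longleftrightarrow>
    (\<Sum>j\<le>2*d. of_real (a (int d - int j)) * X j) = (E - of_real (f \<omega>)) * X d"
proof -
  let ?x = "vec (2 * d) (\<lambda>i. X (Suc i))"
  have "transfer a d f E \<omega> *\<^sub>v ?x = vec (2 * d) X \<longleftrightarrow> (transfer a d f E \<omega> *\<^sub>v ?x) $ 0 = X 0"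
  proof
    assume 0: "(transfer a d f E \<omega> *\<^sub>v ?x) $ 0 = X 0"
    show "transfer a d f E \<omega> *\<^sub>v ?x = vec (2 * d) X"
    proof (rule eq_vecI)
      fix i assume "i < dim_vec (vec (2 * d) X)"
      then show "(transfer a d f E \<omega> *\<^sub>v ?x) $ i = vec (2 * d) X $ i"
        using 0 transfer_mult_Suc[of ?x d "i - 1" a f E \<omega>] by (cases i) (auto simp del: index_mult_mat_vec)
    qed (simp add: transfer_def)
  qed (use assms(1) in simp)
  also have "\<dots> \<longleftrightarrow> (E - of_real (f \<omega>)) * X d
      - (\<Sum>j<2*d. of_real (a (int d - int (Suc j))) * X (Suc j)) = of_real (a (int d)) * X 0"
    using assms by (subst transfer_mult_0) (auto simp: field_simps intro!: sum.cong)
  also have "\<dots> \<longleftrightarrow> (\<Sum>j\<le>2*d. of_real (a (int d - int j)) * X j) = (E - of_real (f \<omega>)) * X d"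
    unfolding lessThan_Suc_atMost[symmetric] sum.lessThan_Suc_shift by (auto simp: algebra_simps)
  finally show ?thesis .
qed

lemma sum_around_center:
  "(\<Sum>j\<le>2*d. g j) = g d + (\<Sum>k=1..d. g (d + k) + g (d - k :: nat))"
proof -
  have "(\<Sum>k=1..d. g (d - k)) = (\<Sum>j<d. g j)"
    by (rule sum.reindex_bij_witness[of _ "\<lambda>j. d - j" "\<lambda>k. d - k"]) auto
  moreover have "(\<Sum>k=1..d. g (d + k)) = (\<Sum>j\<in>{d<..2*d}. g j)"
    by (rule sum.reindex_bij_witness[of _ "\<lambda>j. j - d" "\<lambda>k. d + k"]) auto
  moreover have "{..2*d} = {..<d} \<union> ({d} \<union> {d<..2*d})"
    by auto
  moreover have "sum g ({..<d} \<union> ({d} \<union> {d<..2*d})) = sum g {..<d} + (g d + sum g {d<..2*d})"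
    by (subst sum.union_disjoint, simp, simp, force, subst sum.union_disjoint) auto
  ultimately show ?thesis
    by (simp add: sum.distrib add_ac)
qed

text \<open>Putting the new top entry in front of a vector yields \<open>2 * d + 1\<close> values
  that solve the difference equation at the centre, so \<open>wronskian_shift\<close> applies to
  arbitrary vectors.\<close>

lemma wronskian_transfer:
  assumes d: "1 \<le> d" "a (int d) \<noteq> 0" and sym: "\<And>k. k \<in> {- int d..int d} \<Longrightarrow> a k = a (- k)"
    and x: "x \<in> carrier_vec (2 * d)" and y: "y \<in> carrier_vec (2 * d)"
  shows "wronskian (\<lambda>k. of_real (a (int k))) d (($) (transfer a d f E \<omega> *\<^sub>v x)) (($) (transfer a d f E \<omega> *\<^sub>v y))
    = wronskian (\<lambda>k. of_real (a (int k))) d (($) x) (($) y)"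
proof -
  let ?A = "transfer a d f E \<omega>"
  let ?b = "\<lambda>k. complex_of_real (a (int k))"
  define ext where "ext z i = (case i of 0 \<Rightarrow> (?A *\<^sub>v z) $ 0 | Suc i' \<Rightarrow> z $ i')" for z i
  have ext_eq: "(?A *\<^sub>v z) $ i = ext z i" if "z \<in> carrier_vec (2 * d)" "i < 2 * d" for z i
    using transfer_mult_Suc[OF that(1), of "i - 1"] that(2)
    by (cases i) (auto simp: ext_def simp del: index_mult_mat_vec)
  \<comment> \<open>The diagonal term is absorbed into the common factor
    \<open>e = E - f - a 0\<close>; symmetry of \<open>a\<close> merges the coefficients at distance
    \<open>k\<close> on either side.\<close>
  have rec: "(\<Sum>k=1..d. ?b k * (ext z (d + k) + ext z (d - k))) = (E - of_real (f \<omega>) - ?b 0) * ext z d"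
    if z: "z \<in> carrier_vec (2 * d)" for z
  proof -
    have "vec (2 * d) (\<lambda>i. ext z (Suc i)) = z"
      using z by (intro eq_vecI) (auto simp: ext_def)
    moreover have "?A *\<^sub>v z = vec (2 * d) (ext z)"
    proof (rule eq_vecI)
      show "(?A *\<^sub>v z) $ i = vec (2 * d) (ext z) $ i" if "i < dim_vec (vec (2 * d) (ext z))" for i
        using that by (simp add: ext_eq[OF z] del: index_mult_mat_vec)
    qed (simp add: transfer_def)
    ultimately have "(\<Sum>j\<le>2*d. of_real (a (int d - int j)) * ext z j) = (E - of_real (f \<omega>)) * ext z d"
      using transfer_mult_eq_iff[where a = a and d = d and f = f and E = E and \<omega> = \<omega> and X = "ext z"] d by simp
    moreover have "(\<Sum>k=1..d. of_real (a (int d - int (d + k))) * ext z (d + k) + of_real (a (int d - int (d - k))) * ext z (d - k))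
        = (\<Sum>k=1..d. ?b k * (ext z (d + k) + ext z (d - k)))"
    proof (intro sum.cong refl)
      fix k assume "k \<in> {1..d}"
      then have "a (int d - int (d + k)) = a (int k)" "a (int d - int (d - k)) = a (int k)"
        using sym[of "int k"] by (auto simp: of_nat_diff)
      then show "of_real (a (int d - int (d + k))) * ext z (d + k) + of_real (a (int d - int (d - k))) * ext z (d - k)
          = ?b k * (ext z (d + k) + ext z (d - k))"
        by (simp add: algebra_simps)
    qed
    ultimately show ?thesis
      unfolding sum_around_center by (simp add: algebra_simps)
  qed
  have "wronskian ?b d (($) (?A *\<^sub>v x)) (($) (?A *\<^sub>v y)) = wronskian ?b d (ext x) (ext y)"
    by (intro wronskian_cong ext_eq x y)
  also have "\<dots> = wronskian ?b d (\<lambda>i. ext x (Suc i)) (\<lambda>i. ext y (Suc i))"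
    by (rule wronskian_shift[OF rec[OF x] rec[OF y], symmetric])
  also have "\<dots> = wronskian ?b d (($) x) (($) y)"
    by (simp add: ext_def)
  finally show ?thesis .
qed

lemma wronskian_cocycle:
  assumes "1 \<le> d" "a (int d) \<noteq> 0" "\<And>k. k \<in> {- int d..int d} \<Longrightarrow> a k = a (- k)"
    and "x \<in> carrier_vec (2 * d)" "y \<in> carrier_vec (2 * d)"
  shows "wronskian (\<lambda>k. of_real (a (int k))) d (($) (cocycle_iter (2 * d) T (transfer a d f E) n \<omega> *\<^sub>v x))
      (($) (cocycle_iter (2 * d) T (transfer a d f E) n \<omega> *\<^sub>v y))
    = wronskian (\<lambda>k. of_real (a (int k))) d (($) x) (($) y)"
proof (induction n)
  case 0
  then show ?case using assms(4,5) by simp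
next
  case (Suc n)
  have car: "cocycle_iter (2 * d) T (transfer a d f E) n \<omega> *\<^sub>v z \<in> carrier_vec (2 * d)"
    if "z \<in> carrier_vec (2 * d)" for z
    by (rule mult_mat_vec_carrier[OF cocycle_iter_carrier[OF transfer_carrier] that])
  show ?case
    unfolding cocycle_iter_Suc_apply[OF transfer_carrier assms(4)] cocycle_iter_Suc_apply[OF transfer_carrier assms(5)]
    by (rule trans[OF wronskian_transfer[where a = a and d = d, OF assms(1-3) car[OF assms(4)] car[OF assms(5)]] Suc])
qed

section \<open>Solutions of the eigenvalue equation as orbits of the cocycle\<close>

lemma ipow_Suc:
  assumes "surj T"
  shows "T (ipow T n x) = ipow T (n + 1) x"
proof (cases "n \<ge> 0")
  case True
  then show ?thesis
    by (simp add: ipow_def nat_add_distrib)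
next
  case False
  then obtain k where k: "n = - int (Suc k)"
    by (cases n rule: int_cases) auto
  then have k': "nat (- n) = Suc k" "nat (- n - 1) = k" "n + 1 \<ge> 0 \<longleftrightarrow> k = 0" "nat (n + 1) = 0"
    by auto
  have "ipow T n x = inv_into UNIV T ((inv_into UNIV T ^^ k) x)"
    using False k' by (simp add: ipow_def)
  then have "T (ipow T n x) = (inv_into UNIV T ^^ k) x"
    by (simp only: surj_f_inv_f[OF assms])
  also have "\<dots> = ipow T (n + 1) x"
    using k' by (auto simp: ipow_def)
  finally show ?thesis .
qed

lemma funpow_ipow:
  assumes "surj T"
  shows "(T ^^ k) (ipow T n x) = ipow T (n + int k) x"
  by (induction k) (simp_all add: ipow_Suc[OF assms] add_ac)

text \<open>The state over \<open>ipow T n \<omega>\<close>: entry \<open>d - 1\<close> is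
  \<open>u n\<close>, matching the column of \<open>transfer\<close> that carries
  \<open>E - f\<close>.\<close>

definition window :: "nat \<Rightarrow> (int \<Rightarrow> complex) \<Rightarrow> int \<Rightarrow> complex vec" where
  "window d u n = vec (2 * d) (\<lambda>i. u (n + int d - 1 - int i))"

lemma window_carrier: "window d u n \<in> carrier_vec (2 * d)"
  by (simp add: window_def)

lemma sum_int_range_eq: "(\<Sum>k\<in>{- int d..int d}. g k) = (\<Sum>j\<le>2*d. g (int d - int j))"
  by (rule sum.reindex_bij_witness[of _ "\<lambda>j. int d - int j" "\<lambda>k. nat (int d - k)"]) auto

lemma transfer_window:
  assumes "1 \<le> d" "a (int d) \<noteq> 0" and sol: "Lop a d f T \<omega> u = (\<lambda>n. E * u n)"
  shows "transfer a d f E (ipow T n \<omega>) *\<^sub>v window d u n = window d u (n + 1)"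
proof -
  define X where "X j = u (n + (int d - int j))" for j
  have "(\<Sum>j\<le>2*d. of_real (a (int d - int j)) * X j) = (E - of_real (f (ipow T n \<omega>))) * X d"
    using fun_cong[OF sol, of n] by (simp add: Lop_def sum_int_range_eq X_def algebra_simps)
  then have "transfer a d f E (ipow T n \<omega>) *\<^sub>v vec (2 * d) (\<lambda>i. X (Suc i)) = vec (2 * d) X"
    using assms(1,2) by (simp add: transfer_mult_eq_iff)
  moreover have "vec (2 * d) (\<lambda>i. X (Suc i)) = window d u n" "vec (2 * d) X = window d u (n + 1)"
    by (auto simp: window_def X_def algebra_simps intro!: eq_vecI)
  ultimately show ?thesis by simp
qed

lemma cocycle_window:
  assumes "surj T" "1 \<le> d" "a (int d) \<noteq> 0" and sol: "Lop a d f T \<omega> u = (\<lambda>n. E * u n)"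
  shows "cocycle_iter (2 * d) T (transfer a d f E) k (ipow T n \<omega>) *\<^sub>v window d u n = window d u (n + int k)"
proof (induction k)
  case 0
  then show ?case using window_carrier by simp
next
  case (Suc k)
  then show ?case
    using transfer_window[OF assms(2-4), of "n + int k"]
    by (simp add: cocycle_iter_Suc_apply[OF transfer_carrier window_carrier] funpow_ipow[OF assms(1)] add_ac
        del: cocycle_iter.simps)
qed

text \<open>The sites \<open>-d\<close>, ..., \<open>d - 1\<close> are those of the window at 0; the
  outermost coefficients are nonzero, so the recursion can be run in both directions.\<close>

lemma solution_eq_0:
  assumes d: "1 \<le> d" "a (int d) \<noteq> 0" "a (- int d) \<noteq> 0" and sol: "Lop a d f T \<omega> z = (\<lambda>n. E * z n)"
    and zero: "\<And>i. - int d \<le> i \<Longrightarrow> i < int d \<Longrightarrow> z i = 0"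
  shows "z = (\<lambda>n. 0)"
proof -
  have step: "a k0 = 0 \<or> z (n + k0) = 0"
    if "z n = 0" "k0 \<in> {- int d..int d}" "\<And>k. k \<in> {- int d..int d} \<Longrightarrow> k \<noteq> k0 \<Longrightarrow> z (n + k) = 0" for n k0
  proof -
    have "(\<Sum>k\<in>{- int d..int d}. complex_of_real (a k) * z (n + k)) = 0"
      using fun_cong[OF sol, of n] that(1) by (simp add: Lop_def)
    moreover have "(\<Sum>k\<in>{- int d..int d}. complex_of_real (a k) * z (n + k))
        = (\<Sum>k\<in>{k0}. complex_of_real (a k) * z (n + k))"
      by (rule sum.mono_neutral_right) (use that in auto)
    ultimately show ?thesis by simp
  qed
  have all: "z i = 0" if "- int d - int k \<le> i" "i < int d + int k" for i k
    using that
  proof (induction k arbitrary: i)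
    case 0
    then show ?case using zero by simp
  next
    case (Suc k)
    \<comment> \<open>The equation at site \<open>k\<close> has \<open>z (k + d)\<close> as its only
      value outside the known block; the one at site \<open>- k - 1\<close> does the same at the
      lower end.\<close>
    have up: "z (int k + int d) = 0"
      using step[of "int k" "int d"] d Suc.IH by auto
    have down: "z (- int k - 1 - int d) = 0"
      using step[of "- int k - 1" "- int d"] d Suc.IH by auto
    consider "i = int k + int d" | "i = - int k - 1 - int d" | "- int d - int k \<le> i \<and> i < int d + int k"
      using Suc.prems by force
    then show ?case
      using up down Suc.IH by cases auto
  qed
  have "z i = 0" for i
    by (rule all[where k = "nat \<bar>i\<bar>"]) (use d(1) in auto)
  then show ?thesis by auto
qed

lemma ell2_tendsto_0:
  assumes "u \<in> ell2" "inj g"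
  shows "(\<lambda>k::nat. u (g k)) \<longlonglongrightarrow> 0"
proof -
  have "(\<lambda>n. (cmod (u n))\<^sup>2) summable_on range g"
    using assms(1) by (auto simp: ell2_def intro: summable_on_subset_banach)
  then have "(\<lambda>k. (cmod (u (g k)))\<^sup>2) summable_on UNIV"
    using summable_on_reindex[OF assms(2), of "\<lambda>n. (cmod (u n))\<^sup>2"] by (simp add: o_def)
  then have "(\<lambda>k. (cmod (u (g k)))\<^sup>2) \<longlonglongrightarrow> 0"
    by (intro summable_LIMSEQ_zero summable_on_imp_summable)
  then have "(\<lambda>k. sqrt ((cmod (u (g k)))\<^sup>2)) \<longlonglongrightarrow> sqrt 0"
    by (rule tendsto_real_sqrt)
  then show ?thesis
    by (simp add: tendsto_norm_zero_iff)
qed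

lemma vnorm_window_tendsto_0:
  assumes "u \<in> ell2" "inj g"
  shows "(\<lambda>k::nat. vnorm (window d u (g k))) \<longlonglongrightarrow> 0"
  unfolding vnorm_tendsto_0_iff[of "\<lambda>k. window d u (g k)", OF window_carrier]
proof (intro allI impI)
  fix i assume "i < 2 * d"
  moreover have "(\<lambda>k. u (g k + (int d - 1 - int i))) \<longlonglongrightarrow> 0"
    by (rule ell2_tendsto_0[OF assms(1), of "\<lambda>k. g k + (int d - 1 - int i)"])
       (use assms(2) in \<open>auto simp: inj_def\<close>)
  ultimately show "(\<lambda>k. window d u (g k) $ i) \<longlonglongrightarrow> 0"
    by (simp add: window_def algebra_simps)
qed

lemma wronskian_vnorm_tendsto_0:
  assumes "\<And>k. x k \<in> carrier_vec (2 * d)" "\<And>k. y k \<in> carrier_vec (2 * d)"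
    and "(\<lambda>k. vnorm (x k)) \<longlonglongrightarrow> 0" "(\<lambda>k. vnorm (y k)) \<longlonglongrightarrow> 0"
  shows "(\<lambda>k. wronskian b d (($) (x k)) (($) (y k))) \<longlonglongrightarrow> 0"
  using assms(3,4) unfolding vnorm_tendsto_0_iff[of x, OF assms(1)] vnorm_tendsto_0_iff[of y, OF assms(2)]
  by (intro wronskian_tendsto_0) simp_all

section \<open>Simplicity of the point spectrum\<close>

text \<open>How decay becomes isotropy: a conserved quantity that tends to 0 is 0. It serves forward
  orbits and sequences of preimages alike.\<close>

lemma wronskian_eq_0_of_decay:
  assumes "\<And>k. x k \<in> carrier_vec (2 * d)" "\<And>k. y k \<in> carrier_vec (2 * d)"
    and "(\<lambda>k. vnorm (x k)) \<longlonglongrightarrow> 0" "(\<lambda>k. vnorm (y k)) \<longlonglongrightarrow> 0"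
    and const: "\<And>k. wronskian b d (($) (x k)) (($) (y k)) = c"
  shows "c = 0"
proof -
  have "(\<lambda>k::nat. c) \<longlonglongrightarrow> 0"
    using wronskian_vnorm_tendsto_0[OF assms(1-4), of b] by (simp only: const)
  then show ?thesis
    by (simp add: tendsto_const_iff)
qed

locale dominated_operator = dominated_splitting T "2 * d" "transfer a d f E" Ep Em N
  for T :: "'a::topological_space \<Rightarrow> 'a" and d a f E Ep Em N +
  assumes compact: "compact (UNIV :: 'a set)" and surj: "surj T"
    and d_pos: "1 \<le> d" and lead: "a (int d) \<noteq> 0"
    and a_sym: "\<And>k. k \<in> {- int d..int d} \<Longrightarrow> a k = a (- k)"
    and dim_Ep: "\<And>x. subspace_dim (2 * d) (Ep x) (d + 1)"
    and dim_Em: "\<And>x. \<exists>k. subspace_dim (2 * d) (Em x) k"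
begin

abbreviation coeff where "coeff k \<equiv> complex_of_real (a (int k))"

lemma coeff_lead: "coeff d \<noteq> 0"
  using lead by simp

lemma inj_multiples: "inj (\<lambda>k. int (k * N))" "inj (\<lambda>k. - int (k * N))"
  using N_pos by (auto simp: inj_def)

lemma C_window:
  assumes "Lop a d f T \<omega> u = (\<lambda>n. E * u n)"
  shows "C k (ipow T n \<omega>) *\<^sub>v window d u n = window d u (n + int k)"
  using cocycle_window[where a = a, OF surj d_pos lead assms] .

lemma wronskian_C:
  assumes "x \<in> carrier_vec (2 * d)" "y \<in> carrier_vec (2 * d)"
  shows "wronskian coeff d (($) (C n \<omega> *\<^sub>v x)) (($) (C n \<omega> *\<^sub>v y)) = wronskian coeff d (($) x) (($) y)"
  using wronskian_cocycle[where a = a, OF d_pos lead a_sym assms] .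

text \<open>Otherwise all of \<open>Ep\<close>, of dimension \<open>d + 1\<close>, would decay backward and hence be isotropic.\<close>
lemma window_in_Ep:
  assumes "u \<in> ell2" and sol: "Lop a d f T \<omega> u = (\<lambda>n. E * u n)"
  shows "window d u 0 \<in> Ep \<omega>"
proof (rule ccontr)
  assume notin: "window d u 0 \<notin> Ep \<omega>"
  \<comment> \<open>The cocycle has forward iterates only, so backward decay is expressed by
    preimages over \<open>y k\<close> that reach \<open>\<omega>\<close> after \<open>k * N\<close>
    steps.\<close>
  define y where "y k = ipow T (- int (k * N)) \<omega>" for k
  have base: "(T ^^ (k * N)) (y k) = \<omega>" for k
    unfolding y_def funpow_ipow[OF surj] by (simp add: ipow_def)
  have orbit: "C (k * N) (y k) *\<^sub>v window d u (- int (k * N)) = window d u 0" for k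
    unfolding y_def C_window[OF sol] by simp
  have lim: "(\<lambda>k. vnorm (window d u (- int (k * N)))) \<longlonglongrightarrow> 0"
    by (rule vnorm_window_tendsto_0[OF assms(1) inj_multiples(2)])
  have decay: "\<exists>q. (\<forall>k. q k \<in> carrier_vec (2 * d) \<and> C (k * N) (y k) *\<^sub>v q k = p) \<and> (\<lambda>k. vnorm (q k)) \<longlonglongrightarrow> 0"
    if "p \<in> Ep \<omega>" for p
    by (rule backward_decay[OF compact base window_carrier orbit notin lim that])
  have iso: "wronskian coeff d (($) p) (($) q) = 0" if p: "p \<in> Ep \<omega>" and q: "q \<in> Ep \<omega>" for p q
  proof -
    obtain p' where p': "\<And>k. p' k \<in> carrier_vec (2 * d)" "\<And>k. C (k * N) (y k) *\<^sub>v p' k = p"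
      "(\<lambda>k. vnorm (p' k)) \<longlonglongrightarrow> 0"
      using decay[OF p] by blast
    obtain q' where q': "\<And>k. q' k \<in> carrier_vec (2 * d)" "\<And>k. C (k * N) (y k) *\<^sub>v q' k = q"
      "(\<lambda>k. vnorm (q' k)) \<longlonglongrightarrow> 0"
      using decay[OF q] by blast
    have "wronskian coeff d (($) (p' k)) (($) (q' k)) = wronskian coeff d (($) p) (($) q)" for k
      using wronskian_C[OF p'(1) q'(1), of "k * N" "y k" k k] unfolding p'(2) q'(2) by (rule sym)
    then show ?thesis
      by (rule wronskian_eq_0_of_decay[OF p'(1) q'(1) p'(3) q'(3)])
  qed
  obtain vs where vs: "length vs = d + 1" "lin_indep (2 * d) vs" "Ep \<omega> = cspan (2 * d) vs"
    using dim_Ep[of \<omega>] unfolding subspace_dim_def by blast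
  have "set vs \<subseteq> Ep \<omega>"
    unfolding vs(3) using vs(2) nth_in_cspan by (auto simp: in_set_conv_nth lin_indep_def)
  then have "length vs \<le> d"
    by (intro isotropic_length_le[where b = coeff, OF coeff_lead vs(2)] iso) blast+
  then show False
    using vs(1) by simp
qed

text \<open>Otherwise \<open>Em\<close> and the two eigenvectors would span an isotropic space of dimension \<open>d + 1\<close>.\<close>
lemma windows_dependent:
  assumes "u \<in> ell2" and solu: "Lop a d f T \<omega> u = (\<lambda>n. E * u n)"
    and "v \<in> ell2" and solv: "Lop a d f T \<omega> v = (\<lambda>n. E * v n)"
  shows "\<exists>c e. (c \<noteq> 0 \<or> e \<noteq> 0) \<and> c \<cdot>\<^sub>v window d u 0 + e \<cdot>\<^sub>v window d v 0 = 0\<^sub>v (2 * d)"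
proof (rule ccontr)
  let ?U = "window d u 0" and ?V = "window d v 0"
  assume "\<not> ?thesis"
  then have indep: "c = 0 \<and> e = 0" if "c \<cdot>\<^sub>v ?U + e \<cdot>\<^sub>v ?V = 0\<^sub>v (2 * d)" for c e
    using that by blast
  have mem: "?U \<in> Ep \<omega>" "?V \<in> Ep \<omega>"
    by (rule window_in_Ep[OF assms(1,2)], rule window_in_Ep[OF assms(3,4)])
  \<comment> \<open>\<open>?U\<close> will be the nonzero reference vector of \<open>Ep\<close> in
    \<open>forward_decay\<close>.\<close>
  have "?U \<noteq> 0\<^sub>v (2 * d)"
  proof
    assume "?U = 0\<^sub>v (2 * d)"
    then have "1 \<cdot>\<^sub>v ?U + 0 \<cdot>\<^sub>v ?V = 0\<^sub>v (2 * d)"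
      by (intro eq_vecI) (auto simp: window_def)
    then show False
      using indep[of 1 0] by simp
  qed
  obtain k ws where ws: "length ws = k" "lin_indep (2 * d) ws" "Em \<omega> = cspan (2 * d) ws"
    and k: "subspace_dim (2 * d) (Em \<omega>) k"
    using dim_Em[of \<omega>] unfolding subspace_dim_def by blast
  have car: "set ws \<subseteq> carrier_vec (2 * d)"
    using ws(2) by (simp add: lin_indep_def)
  have car': "set (ws @ [?U, ?V]) \<subseteq> carrier_vec (2 * d)"
    using car window_carrier by simp
  have ws_Em: "set ws \<subseteq> Em \<omega>"
    unfolding ws(3) using car nth_in_cspan by (auto simp: in_set_conv_nth)
  have base: "ipow T 0 \<omega> = \<omega>"
    by (simp add: ipow_def)
  have "(\<lambda>k. vnorm (C (k * N) \<omega> *\<^sub>v ?U)) \<longlonglongrightarrow> 0" "(\<lambda>k. vnorm (C (k * N) \<omega> *\<^sub>v ?V)) \<longlonglongrightarrow> 0"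
    using C_window[OF solu, of _ 0] C_window[OF solv, of _ 0]
      vnorm_window_tendsto_0[OF assms(1) inj_multiples(1)] vnorm_window_tendsto_0[OF assms(3) inj_multiples(1)]
    by (simp_all add: base)
  then have decay: "(\<lambda>k. vnorm (C (k * N) \<omega> *\<^sub>v x)) \<longlonglongrightarrow> 0" if "x \<in> set (ws @ [?U, ?V])" for x
    using that forward_decay[OF mem(1) \<open>?U \<noteq> 0\<^sub>v (2 * d)\<close>] ws_Em by auto
  have iso: "wronskian coeff d (($) x) (($) y) = 0"
    if x: "x \<in> set (ws @ [?U, ?V])" and y: "y \<in> set (ws @ [?U, ?V])" for x y
  proof (rule wronskian_eq_0_of_decay[OF _ _ decay[OF x] decay[OF y]])
    have xy: "x \<in> carrier_vec (2 * d)" "y \<in> carrier_vec (2 * d)"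
      using x y car' by blast+
    then show "C (k * N) \<omega> *\<^sub>v x \<in> carrier_vec (2 * d)" "C (k * N) \<omega> *\<^sub>v y \<in> carrier_vec (2 * d)" for k
      using mult_mat_vec_carrier[OF C_carrier] by blast+
    show "wronskian coeff d (($) (C (k * N) \<omega> *\<^sub>v x)) (($) (C (k * N) \<omega> *\<^sub>v y)) = wronskian coeff d (($) x) (($) y)" for k
      by (rule wronskian_C[OF xy])
  qed
  have "lin_indep (2 * d) (ws @ [?U, ?V])"
    unfolding lin_indep_def
  proof (intro conjI allI impI)
    show "set (ws @ [?U, ?V]) \<subseteq> carrier_vec (2 * d)"
      by (rule car')
    fix c i
    assume z: "finsum_vec TYPE(complex) (2 * d) (\<lambda>i. c i \<cdot>\<^sub>v (ws @ [?U, ?V]) ! i) {..<length (ws @ [?U, ?V])} = 0\<^sub>v (2 * d)"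
      and i: "i < length (ws @ [?U, ?V])"
    define w where "w = finsum_vec TYPE(complex) (2 * d) (\<lambda>i. c i \<cdot>\<^sub>v ws ! i) {..<length ws}"
    define p where "p = c k \<cdot>\<^sub>v ?U + c (Suc k) \<cdot>\<^sub>v ?V"
    have wp: "w \<in> Em \<omega>" "p \<in> Ep \<omega>"
      unfolding w_def p_def ws(3) by (auto simp: cspan_def intro!: Ep_lincomb mem)
    have wpc: "w \<in> carrier_vec (2 * d)" "p \<in> carrier_vec (2 * d)"
      using wp Ep_subset Em_subset by blast+
    have r: "w $ r + p $ r = 0" if "r < 2 * d" for r
    proof -
      have "0 = (\<Sum>i<k + 2. c i * (ws @ [?U, ?V]) ! i $ r)"
        using arg_cong[OF z, of "\<lambda>v. v $ r"] that unfolding lincomb_index[OF car' that] by (simp add: ws(1))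
      also have "\<dots> = (\<Sum>i<k. c i * ws ! i $ r) + (c k * ?U $ r + c (Suc k) * ?V $ r)"
        by (simp add: ws(1) nth_append numeral_2_eq_2)
      also have "\<dots> = w $ r + p $ r"
        unfolding w_def lincomb_index[OF car that] p_def using that by (simp add: ws(1) window_def)
      finally show ?thesis by simp
    qed
    \<comment> \<open>The relation separates into \<open>p\<close> in \<open>Ep\<close> and
      \<open>w\<close> in \<open>Em\<close> with \<open>w + p = 0\<close>; both vanish since the
      subspaces meet trivially.\<close>
    have "p = (-1) \<cdot>\<^sub>v w"
      using wpc r by (intro eq_vecI) (auto simp: eq_neg_iff_add_eq_0 add.commute)
    then have "p \<in> Ep \<omega> \<inter> Em \<omega>"
      using wp Em_smult[OF wp(1), of "-1"] by simp
    then have p0: "p = 0\<^sub>v (2 * d)"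
      using disjoint by blast
    then have "w = 0\<^sub>v (2 * d)"
      using r wpc by (intro eq_vecI) auto
    then have "\<forall>i<k. c i = 0"
      using ws(1,2) unfolding lin_indep_def w_def by blast
    moreover have "c k = 0" "c (Suc k) = 0"
      using indep[of "c k" "c (Suc k)"] p0 by (simp_all add: p_def)
    moreover have "i < k \<or> i = k \<or> i = Suc k"
      using i ws(1) by auto
    ultimately show "c i = 0" by blast
  qed
  from isotropic_length_le[where b = coeff, OF coeff_lead this iso]
  have "k + 2 \<le> d"
    by (simp add: ws(1))
  \<comment> \<open>This gives \<open>k + 2 \<ge> d + 1\<close>, one more than isotropy
    allows.\<close>
  moreover have "2 * d \<le> d + 1 + k"
    by (rule dim_le_sum_dims[OF dim_Ep k sum_eq])
  ultimately show False by simp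
qed

end

section \<open>From dependent windows to a one-dimensional eigenspace\<close>

lemma Lop_lincomb: "Lop a d f T \<omega> (\<lambda>n. c * u n + e * v n) = (\<lambda>n. c * Lop a d f T \<omega> u n + e * Lop a d f T \<omega> v n)"
  by (simp add: Lop_def fun_eq_iff sum_distrib_left algebra_simps sum.distrib)

lemma ell2_scale:
  assumes "u \<in> ell2"
  shows "(\<lambda>n. c * u n) \<in> ell2"
  using assms summable_on_cmult_right[of "\<lambda>n. (cmod (u n))\<^sup>2" UNIV "(cmod c)\<^sup>2"]
  by (simp add: ell2_def norm_mult power_mult_distrib)

text \<open>\<open>PH2\<close> speaks only of points of the spectrum; a nonzero eigenfunction puts
  \<open>E\<close> there by destroying injectivity.\<close>

lemma eigenvalue_in_Sigma:
  assumes "u \<in> eigenspace_L a d f T \<omega> E" "u \<noteq> (\<lambda>n. 0)"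
  shows "E \<in> Sigma_f a d f T"
proof -
  let ?F = "\<lambda>u n. Lop a d f T \<omega> u n - E * u n"
  have "?F u = ?F (\<lambda>n. 0)"
    using assms(1) by (simp add: eigenspace_L_def fun_eq_iff Lop_def)
  moreover have "u \<in> ell2" "(\<lambda>n. 0) \<in> ell2"
    using assms(1) by (auto simp: eigenspace_L_def ell2_def)
  ultimately have "\<not> inj_on ?F ell2"
    using assms(2) inj_onD[of ?F ell2 u "\<lambda>n. 0"] by blast
  then show ?thesis
    unfolding Sigma_f_def op_spectrum_def bij_betw_def by blast
qed

theorem theorem1p4:
  fixes T :: "'a::metric_space \<Rightarrow> 'a" and M :: "'a measure" and f :: "'a \<Rightarrow> real"
    and a :: "int \<Rightarrow> real" and d :: nat
  assumes "compact (UNIV :: 'a set)"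
    and "minimal_homeo T"
    and "prob_space M" and "sets M = sets borel" and "invariant_ergodic M T"
    and "continuous_on UNIV f"
    and "d \<ge> 1" and "\<forall>k\<in>{- int d..int d}. a k = a (- k)" and "a (int d) \<noteq> 0"
    and "PH2 M T a d f"
  shows "\<forall>\<omega> E. is_eigenvalue_L a d f T \<omega> E \<longrightarrow>
           (\<exists>w. w \<noteq> (\<lambda>n. 0) \<and> eigenspace_L a d f T \<omega> E = {(\<lambda>n. c * w n) | c. True})"
proof (intro allI impI)
  fix \<omega> E
  assume "is_eigenvalue_L a d f T \<omega> E"
  then obtain w where w: "w \<in> eigenspace_L a d f T \<omega> E" "w \<noteq> (\<lambda>n. 0)"
    unfolding is_eigenvalue_L_def by blast
  have w': "w \<in> ell2" "Lop a d f T \<omega> w = (\<lambda>n. E * w n)"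
    using w(1) by (auto simp: eigenspace_L_def)
  have surj: "surj T"
    using assms(2) unfolding minimal_homeo_def homeomorphism_def by blast
  have neg: "a (- int d) \<noteq> 0"
    using bspec[OF assms(8), of "int d"] assms(9) by simp
  have "dominated T (2 * d) (transfer a d f E) (d + 1)"
    using assms(10) eigenvalue_in_Sigma[OF w] unfolding PH2_def by blast
  then obtain Ep Em N where split: "dominated_splitting T (2 * d) (transfer a d f E) Ep Em N"
    and dims: "\<forall>x. subspace_dim (2 * d) (Ep x) (d + 1) \<and> (\<exists>k'. subspace_dim (2 * d) (Em x) k')"
    by (rule dominated_obtains_splitting[OF transfer_carrier]) (rule that)
  interpret dominated_operator T d a f E Ep Em N
    by (intro dominated_operator.intro dominated_operator_axioms.intro split assms(1,7,9) surj
        bspec[OF assms(8)] conjunct1[OF spec[OF dims]] conjunct2[OF spec[OF dims]])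
  have multiple: "\<exists>c. u = (\<lambda>n. c * w n)" if u: "u \<in> eigenspace_L a d f T \<omega> E" for u
  proof -
    have u': "u \<in> ell2" "Lop a d f T \<omega> u = (\<lambda>n. E * u n)"
      using u by (auto simp: eigenspace_L_def)
    obtain c e where ce: "c \<noteq> 0 \<or> e \<noteq> 0" "c \<cdot>\<^sub>v window d w 0 + e \<cdot>\<^sub>v window d u 0 = 0\<^sub>v (2 * d)"
      using windows_dependent[OF w' u'] by blast
    have "(\<lambda>n. c * w n + e * u n) = (\<lambda>n. 0)"
    proof (rule solution_eq_0[OF assms(7,9) neg])
      show "Lop a d f T \<omega> (\<lambda>n. c * w n + e * u n) = (\<lambda>n. E * (c * w n + e * u n))"
        unfolding Lop_lincomb w'(2) u'(2) by (simp add: algebra_simps)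
      show "c * w i + e * u i = 0" if "- int d \<le> i" "i < int d" for i
      \<comment> \<open>\<open>nat (int d - 1 - i)\<close> is the position of site \<open>i\<close>
        in the window at 0.\<close>
      proof -
        have "nat (int d - 1 - i) < 2 * d"
          using that by linarith
        then show ?thesis
          using arg_cong[OF ce(2), of "\<lambda>v. v $ nat (int d - 1 - i)"] that by (simp add: window_def)
      qed
    qed
    then have z: "c * w n + e * u n = 0" for n
      by (rule fun_cong)
    \<comment> \<open>With \<open>e = 0\<close> the coefficient \<open>c\<close> is nonzero, and
      \<open>w\<close> would vanish identically.\<close>
    have "e \<noteq> 0"
    proof
      assume "e = 0"
      then have "w n = 0" for n
        using z[of n] ce(1) by simp
      then show False
        using w(2) by blast
    qed
    then have "u n = (- c / e) * w n" for n
      using z[of n] by (simp add: field_simps eq_neg_iff_add_eq_0)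
    then show ?thesis by blast
  qed
  have "(\<lambda>n. c * w n) \<in> eigenspace_L a d f T \<omega> E" for c
    using Lop_lincomb[of a d f T \<omega> c w 0 w] ell2_scale[OF w'(1), of c] w'(2)
    by (simp add: eigenspace_L_def fun_eq_iff)
  then have "eigenspace_L a d f T \<omega> E = {(\<lambda>n. c * w n) | c. True}"
    using multiple by blast
  then show "\<exists>w. w \<noteq> (\<lambda>n. 0) \<and> eigenspace_L a d f T \<omega> E = {(\<lambda>n. c * w n) | c. True}"
    using w(2) by blast
qed

end
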